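(* Let $X\subseteq\mathbb{Z}^n$ be a based digital image with basepoint $x_0$. For each $k\ge1$, the standard projection $\rho_k\colon S(X,k)\to X$ induces an isomorphism of fundamental groups $$(\rho_k)_*\colon \pi_1(S(X,k);\overline{x_0})\to\pi_1(X;x_0).$$
   Context: A digital image is a finite subset $X \subseteq \mathbb{Z}^n$ with adjacency relation $x \sim_X x'$ iff $|x_i - x'_i| \le 1$ for every $i=1,\dots,n$. A function of digital images is continuous if it sends adjacent points to adjacent points; a based map is a continuous function preserving basepoints. $I_N = \{0,1,\dots,N\}\subseteq\mathbb{Z}$; products of digital images are Cartesian products with adjacency in each factor. For $k\ge1$, the $k$-subdivision of $X\subseteq\mathbb{Z}^n$ is $S(X,k)=\{(y_1,\dots,y_n)\in\mathbb{Z}^n : (\lfloor y_1/k\rfloor,\dots,\lfloor y_n/k\rfloor)\in X\}$, with standard projection $\rho_k(y_1,\dots,y_n)=(\lfloor y_1/k\rfloor,\dots,\lfloor y_n/k\rfloor)$, which is continuous ($S(X,1)=X$, $\rho_1=\mathrm{id}$). If $X$ has basepoint $x_0=(a_1,\dots,a_n)$, the basepoint of $S(X,k)$ is $\overline{x_0}=(ka_1+c,\dots,ka_n+c)$ with $c=\lfloor (k-1)/2\rfloor$ (so $c=j-1$ if $k=2j$ and $c=j$ if $k=2j+1$). Then $\rho_k$ is a based map. For intervals, $S(I_N,k)=I_{kN+k-1}$ and $\rho_k(s)=\lfloor s/k\rfloor$; the basepoint of any interval $I_N$ is $0$. For a based digital image $(Y,y_0)$, a based loop of length $N\ge 1$ is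 a continuous $\gamma\colon I_N\to Y$ with $\gamma(0)=\gamma(N)=y_0$. Based loops $\alpha,\beta\colon I_M\to Y$ are based homotopic as based loops, $\alpha\approx\beta$, if for some $R\ge1$ there is a continuous $H\colon I_M\times I_R\to Y$ with $H(s,0)=\alpha(s)$, $H(s,R)=\beta(s)$ and $H(0,t)=H(M,t)=y_0$ for all $s,t$. Based loops $\alpha\colon I_M\to Y$, $\beta\colon I_N\to Y$ are subdivision-based homotopic as based loops if for some $k,l\ge1$ with $k(M+1)=l(N+1)$ we have $\alpha\circ\rho_k\approx\beta\circ\rho_l$ as based loops. This is an equivalence relation; $[\alpha]$ is the class of $\alpha$ and $\pi_1(Y;y_0)$ the set of classes. It is a group under $[\alpha]\cdot[\beta]=[\alpha\cdot\beta]$, where $\alpha\cdot\beta\colon I_{M+N+1}\to Y$ is $\alpha(t)$ for $0\le t\le M$ and $\beta(t-(M+1))$ for $M+1\le t\le M+N+1$. A based map $f\colon X\to Y$ induces the homomorphism $f_*([\alpha])=[f\circ\alpha]$. *)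

theory Defs
  imports "HOL-Analysis.Finite_Cartesian_Product" "HOL-Algebra.Group"
begin

text \<open>Adjacency is reflexive here: every point is adjacent to itself. On products and on
  \<open>\<int>\<^sup>n\<close> (rendered as \<open>int ^ 'n\<close>) it is adjacency in each factor or coordinate.\<close>

class adjacency =
  fixes adjacent :: "'a \<Rightarrow> 'a \<Rightarrow> bool"

instantiation int :: adjacency
begin
definition adjacent_int :: "int \<Rightarrow> int \<Rightarrow> bool" where
  "adjacent_int x y \<longleftrightarrow> \<bar>x - y\<bar> \<le> 1"
instance ..
end

instantiation prod :: (adjacency, adjacency) adjacency
begin
definition adjacent_prod :: "'a \<times> 'b \<Rightarrow> 'a \<times> 'b \<Rightarrow> bool" where
  "adjacent_prod x y \<longleftrightarrow> adjacent (fst x) (fst y) \<and> adjacent (snd x) (snd y)"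
instance ..
end

instantiation vec :: (adjacency, finite) adjacency
begin
definition adjacent_vec :: "'a ^ 'b \<Rightarrow> 'a ^ 'b \<Rightarrow> bool" where
  "adjacent_vec x y \<longleftrightarrow> (\<forall>i. adjacent (x $ i) (y $ i))"
instance ..
end

definition digitally_continuous ::
    "'a::adjacency set \<Rightarrow> 'b::adjacency set \<Rightarrow> ('a \<Rightarrow> 'b) \<Rightarrow> bool" where
  "digitally_continuous X Y f \<longleftrightarrow>
     f ` X \<subseteq> Y \<and> (\<forall>x\<in>X. \<forall>x'\<in>X. adjacent x x' \<longrightarrow> adjacent (f x) (f x'))"

definition interval :: "nat \<Rightarrow> int set" where
  "interval N = {0..int N}"

definition interval_proj :: "nat \<Rightarrow> int \<Rightarrow> int" where
  "interval_proj k s = s div int k"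

text \<open>\<open>div\<close> on \<open>int\<close> rounds towards minus infinity, so it is \<open>\<lfloor>y / k\<rfloor>\<close> for
  \<open>k \<ge> 1\<close>, also for negative coordinates.\<close>

definition standard_proj :: "nat \<Rightarrow> int ^ 'n \<Rightarrow> int ^ 'n" where
  "standard_proj k y = (\<chi> i. (y $ i) div int k)"

definition subdivision :: "(int ^ 'n) set \<Rightarrow> nat \<Rightarrow> (int ^ 'n) set" where
  "subdivision X k = {y. standard_proj k y \<in> X}"

definition subdivision_basepoint :: "int ^ 'n \<Rightarrow> nat \<Rightarrow> int ^ 'n" where
  "subdivision_basepoint x0 k = (\<chi> i. int k * (x0 $ i) + (int k - 1) div 2)"

text \<open>A loop is a pair of its length \<open>N\<close> and a function of which only the values on
  \<open>interval N\<close> matter: loops that agree there are identified in the fundamental group.\<close>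

type_synonym 'a loop = "nat \<times> (int \<Rightarrow> 'a)"

definition based_loops :: "'a::adjacency set \<Rightarrow> 'a \<Rightarrow> 'a loop set" where
  "based_loops Y y0 =
     {(N, \<gamma>). N \<ge> 1 \<and> digitally_continuous (interval N) Y \<gamma> \<and> \<gamma> 0 = y0 \<and> \<gamma> (int N) = y0}"

definition based_homotopic ::
    "'a::adjacency set \<Rightarrow> 'a \<Rightarrow> nat \<Rightarrow> (int \<Rightarrow> 'a) \<Rightarrow> (int \<Rightarrow> 'a) \<Rightarrow> bool" where
  "based_homotopic Y y0 M \<alpha> \<beta> \<longleftrightarrow>
     (\<exists>R\<ge>1. \<exists>H. digitally_continuous (interval M \<times> interval R) Y H \<and>
        (\<forall>s\<in>interval M. H (s, 0) = \<alpha> s \<and> H (s, int R) = \<beta> s) \<and>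
        (\<forall>t\<in>interval R. H (0, t) = y0 \<and> H (int M, t) = y0))"

text \<open>The \<open>k\<close>-subdivision of \<open>interval M\<close> is \<open>interval (k * M + k - 1)\<close>.\<close>

definition loop_rel :: "'a::adjacency set \<Rightarrow> 'a \<Rightarrow> ('a loop \<times> 'a loop) set" where
  "loop_rel Y y0 =
     {((M, \<alpha>), (N, \<beta>)). (M, \<alpha>) \<in> based_loops Y y0 \<and> (N, \<beta>) \<in> based_loops Y y0 \<and>
        (\<exists>k\<ge>1. \<exists>l\<ge>1. k * (M + 1) = l * (N + 1) \<and>
           based_homotopic Y y0 (k * M + k - 1) (\<alpha> \<circ> interval_proj k) (\<beta> \<circ> interval_proj l))}"

definition loop_concat :: "'a loop \<Rightarrow> 'a loop \<Rightarrow> 'a loop" where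
  "loop_concat p q =
     (fst p + fst q + 1,
      \<lambda>t. if t \<le> int (fst p) then snd p t else snd q (t - (int (fst p) + 1)))"

text \<open>Operations on classes are given as unions over all representatives; since they respect
  the relation, each such union is the class of any one of the results.\<close>

definition fundamental_group :: "'a::adjacency set \<Rightarrow> 'a \<Rightarrow> 'a loop set monoid" where
  "fundamental_group Y y0 =
     \<lparr>carrier = based_loops Y y0 // loop_rel Y y0,
      monoid.mult = (\<lambda>A B. \<Union>p\<in>A. \<Union>q\<in>B. loop_rel Y y0 `` {loop_concat p q}),
      one = loop_rel Y y0 `` {(1, \<lambda>_. y0)}\<rparr>"

definition induced_map ::
    "'b::adjacency set \<Rightarrow> 'b \<Rightarrow> ('a::adjacency \<Rightarrow> 'b) \<Rightarrow> 'a loop set \<Rightarrow> 'b loop set" where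
  "induced_map Y y0 f A = (\<Union>p\<in>A. loop_rel Y y0 `` {(fst p, f \<circ> snd p)})"

end

theory Submission imports Defs begin

text \<open>Subdividing a loop does not change its class, so the projection \<open>\<rho>\<close> of the
  \<open>k\<close>-subdivision is bijective on fundamental groups as soon as loops and homotopies in \<open>X\<close> can be
  lifted through \<open>\<rho>\<close> after a subdivision of their domain. Lifting a loop gives surjectivity, and
  lifting a homotopy between \<open>\<rho> \<circ> \<gamma>\<close> and \<open>\<rho> \<circ> \<delta>\<close> gives a homotopy between subdivisions
  of \<open>\<gamma>\<close> and \<open>\<delta>\<close>, that is, injectivity.

  Both lifting problems are scalar Lipschitz extension problems. Adjacency in \<open>\<int>\<^sup>n\<close> is tested in each
  coordinate, and an integer function on a box of \<open>\<int>\<^sup>2\<close> preserves adjacency exactly when it is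
  1-Lipschitz for the sup distance. So let \<open>a\<close> be a coordinate of the map to be lifted and subdivide
  the box by \<open>K\<close>. A lift is a 1-Lipschitz function \<open>h\<close> with
  \<open>k * a(x) \<le> h \<le> k * a(x) + k - 1\<close> on the block over \<open>x\<close>. By the construction of McShane,
  a 1-Lipschitz function with given lower and upper bounds exists as soon as every lower bound
  exceeds every upper bound by at most the distance of the two points (\<open>short_extension_between\<close>).
  For points over \<open>x\<close> and \<open>x'\<close>, at sup distance \<open>d > 0\<close> from each other, the excess is at most
  \<open>k * d - k + 1\<close> while the distance is at least \<open>K * d - K + 1\<close>; so \<open>K \<ge> k\<close> suffices,
  whatever the parity of \<open>k\<close>.

  The lifts have to respect basepoints, and lifted homotopies have to begin and end at given loops.
  Such prescribed values are bounds whose lower and upper parts coincide. They remain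
  compatible with the rest for \<open>K = k\<close> if only the two end points of an interval are prescribed
  (\<open>loop_lift\<close>), and for \<open>K = 3 * k\<close> if the whole frame of a box is (\<open>short_lift_rel_frame\<close>,
  \<open>homotopy_lift\<close>).

  Multiplicativity uses lifts again. The product of two classes is the union of the classes of
  \<open>p \<cdot> q\<close> over all representatives. Arbitrary representatives \<open>p'\<close>, \<open>q'\<close> of the image
  classes lift to \<open>p\<close>, \<open>q\<close> in the given classes, with the same factor \<open>k\<close>; then
  \<open>\<rho> \<circ> (p \<cdot> q)\<close> is the \<open>k\<close>-subdivision of \<open>p' \<cdot> q'\<close>, hence in the same class
  (\<open>induced_map_standard_proj_mult\<close>).\<close>

section \<open>Adjacency and 1-Lipschitz functions on boxes\<close>

definition sup_dist :: "int \<times> int \<Rightarrow> int \<times> int \<Rightarrow> int" where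
  "sup_dist p q = max \<bar>fst p - fst q\<bar> \<bar>snd p - snd q\<bar>"

definition short_on :: "(int \<times> int) set \<Rightarrow> (int \<times> int \<Rightarrow> int) \<Rightarrow> bool" where
  "short_on D f \<longleftrightarrow> (\<forall>p\<in>D. \<forall>q\<in>D. f p - f q \<le> sup_dist p q)"

lemma short_onD: "short_on D f \<Longrightarrow> p \<in> D \<Longrightarrow> q \<in> D \<Longrightarrow> \<bar>f p - f q\<bar> \<le> sup_dist p q"
  unfolding short_on_def sup_dist_def by (smt (verit, best))

lemma adjacent_iff_sup_dist: "adjacent p q \<longleftrightarrow> sup_dist p q \<le> 1"
  by (simp add: adjacent_prod_def adjacent_int_def sup_dist_def)

text \<open>Any point of a box is reached from any other one by as many diagonal steps inside the box as
  their sup distance, so the bound for adjacent points adds up along the way.\<close>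

lemma short_on_if_adjacent:
  assumes "\<And>p q. p \<in> interval L \<times> interval R \<Longrightarrow> q \<in> interval L \<times> interval R \<Longrightarrow>
    adjacent p q \<Longrightarrow> adjacent (f p) (f q)"
  shows "short_on (interval L \<times> interval R) f"
proof -
  have "\<bar>f p - f q\<bar> \<le> int n" if "sup_dist p q \<le> int n"
    "p \<in> interval L \<times> interval R" "q \<in> interval L \<times> interval R" for n p q
    using that
  proof (induction n arbitrary: q)
    case 0
    then have "p = q" by (auto simp: sup_dist_def prod_eq_iff)
    then show ?case by simp
  next
    case (Suc n)
    \<comment> \<open>One diagonal step from \<open>q\<close> towards \<open>p\<close>.\<close>
    define r where "r = (fst q + sgn (fst p - fst q), snd q + sgn (snd p - snd q))"
    have r: "r \<in> interval L \<times> interval R"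
      using Suc.prems by (auto simp: r_def interval_def sgn_if)
    have "sup_dist p r \<le> int n"
      using Suc.prems(1) by (auto simp: r_def sup_dist_def sgn_if split: if_splits)
    with Suc r have "\<bar>f p - f r\<bar> \<le> int n" by blast
    moreover have "adjacent r q"
      by (auto simp: adjacent_iff_sup_dist sup_dist_def r_def sgn_if)
    then have "\<bar>f r - f q\<bar> \<le> 1"
      using assms[OF r Suc.prems(3)] by (simp add: adjacent_int_def)
    ultimately show ?case by simp
  qed
  from this[of _ _ "nat (sup_dist _ _)"] show ?thesis
    unfolding short_on_def
    by (smt (verit) nat_0_le sup_dist_def)
qed

lemma short_on_component:
  assumes "digitally_continuous (interval L \<times> interval R) Y H"
  shows "short_on (interval L \<times> interval R) (\<lambda>p. H p $ i)"
  using assms by (intro short_on_if_adjacent) (auto simp: digitally_continuous_def adjacent_vec_def)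

lemma short_path_component:
  assumes "digitally_continuous (interval N) Y \<gamma>" "s \<in> interval N" "s' \<in> interval N"
  shows "\<bar>\<gamma> s $ i - \<gamma> s' $ i\<bar> \<le> \<bar>s - s'\<bar>"
proof -
  have "short_on (interval N \<times> interval 0) (\<lambda>p. \<gamma> (fst p) $ i)"
    using assms(1)
    by (intro short_on_if_adjacent) (auto simp: digitally_continuous_def adjacent_vec_def adjacent_prod_def)
  from short_onD[OF this, of "(s, 0)" "(s', 0)"] assms(2,3)
  show ?thesis by (simp add: interval_def sup_dist_def)
qed

text \<open>McShane's construction: the largest of the cones \<open>lower q - sup_dist p q\<close>. It lies above
  \<open>lower\<close> because the cone at \<open>p\<close> itself takes part, and below \<open>upper\<close> by the hypothesis.\<close>

lemma short_extension_between:
  assumes "finite D"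
    and "\<And>p q. p \<in> D \<Longrightarrow> q \<in> D \<Longrightarrow> lower p - upper q \<le> sup_dist p q"
  obtains h where "short_on D h" "\<And>p. p \<in> D \<Longrightarrow> lower p \<le> h p \<and> h p \<le> upper p"
proof
  define h where "h p = Max ((\<lambda>q. lower q - sup_dist p q) ` D)" for p
  have ge: "lower q - sup_dist p q \<le> h p" if "q \<in> D" for p q
    unfolding h_def using assms(1) that by (intro Max_ge) auto
  have attained: "\<exists>q\<in>D. h p = lower q - sup_dist p q" if "r \<in> D" for p r
  proof -
    have "h p \<in> (\<lambda>q. lower q - sup_dist p q) ` D"
      unfolding h_def using assms(1) that by (intro Max_in) auto
    then show ?thesis by blast
  qed
  have triangle: "sup_dist q r \<le> sup_dist p q + sup_dist p r" for p q r
    by (auto simp: sup_dist_def)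
  show "short_on D h"
    unfolding short_on_def
  proof (intro ballI)
    fix p q assume "p \<in> D" "q \<in> D"
    then obtain r where "r \<in> D" "h p = lower r - sup_dist p r" using attained by blast
    with ge[of r q] triangle[of q r p] show "h p - h q \<le> sup_dist p q"
      by linarith
  qed
  show "lower p \<le> h p \<and> h p \<le> upper p" if "p \<in> D" for p
  proof
    show "lower p \<le> h p" using ge[OF that, of p] by (simp add: sup_dist_def)
    obtain r where "r \<in> D" "h p = lower r - sup_dist p r" using attained \<open>p \<in> D\<close> by blast
    with assms(2)[OF \<open>r \<in> D\<close> that] show "h p \<le> upper p"
      by (simp add: sup_dist_def abs_minus_commute)
  qed
qed

section \<open>Blocks of a subdivided box\<close>

lemma div_eq_iff_between:
  assumes "k \<ge> 1"
  shows "(h::int) div int k = a \<longleftrightarrow> int k * a \<le> h \<and> h \<le> int k * a + int k - 1"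
proof
  assume "h div int k = a"
  then have "int k * a = h - h mod int k" using minus_mod_eq_mult_div[of h "int k"] by simp
  moreover have "0 \<le> h mod int k" "h mod int k < int k" using assms by simp_all
  ultimately show "int k * a \<le> h \<and> h \<le> int k * a + int k - 1" by linarith
next
  assume "int k * a \<le> h \<and> h \<le> int k * a + int k - 1"
  then show "h div int k = a"
    using assms by (intro int_div_pos_eq[where r = "h - int k * a"]) auto
qed

definition block :: "nat \<Rightarrow> int \<times> int \<Rightarrow> int \<times> int" where
  "block K = map_prod (interval_proj K) (interval_proj K)"

abbreviation subdivided_length :: "nat \<Rightarrow> nat \<Rightarrow> nat" where
  "subdivided_length K N \<equiv> K * N + K - 1"

lemma interval_proj_in:
  assumes "K \<ge> 1" "s \<in> interval (subdivided_length K N)"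
  shows "interval_proj K s \<in> interval N"
proof -
  have "s \<le> int K * int N + int K - 1"
    using assms by (auto simp: interval_def of_nat_diff)
  then have "s div int K \<le> (int K * int N + int K - 1) div int K"
    using assms(1) by (intro zdiv_mono1) auto
  also have "\<dots> = int N"
    using assms(1) by (simp add: div_eq_iff_between)
  finally show ?thesis
    using assms by (auto simp: interval_def interval_proj_def pos_imp_zdiv_nonneg_iff)
qed

lemma block_in:
  assumes "K \<ge> 1" "p \<in> interval (subdivided_length K L) \<times> interval (subdivided_length K R)"
  shows "block K p \<in> interval L \<times> interval R"
  using assms interval_proj_in[of K] by (auto simp: block_def)

lemma block_distance:
  assumes "K \<ge> 1"
  shows "int K * \<bar>interval_proj K s - interval_proj K s'\<bar> \<le> \<bar>s - s'\<bar> + int K - 1"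
proof -
  have "int K * interval_proj K u \<le> u \<and> u \<le> int K * interval_proj K u + int K - 1" for u
    using div_eq_iff_between[OF assms, of u "u div int K"] by (simp add: interval_proj_def)
  from this[of s] this[of s'] show ?thesis
    by (simp add: abs_if right_diff_distrib)
qed

lemma interval_proj_short:
  assumes "K \<ge> 1"
  shows "\<bar>interval_proj K s - interval_proj K s'\<bar> \<le> \<bar>s - s'\<bar>"
proof (cases "interval_proj K s = interval_proj K s'")
  case False
  define d where "d = \<bar>interval_proj K s - interval_proj K s'\<bar>"
  have "d \<ge> 1" using False by (simp add: d_def)
  then have "(int K - 1) * 1 \<le> (int K - 1) * d" using assms by (intro mult_left_mono) auto
  then show ?thesis using block_distance[OF assms, of s s'] by (simp add: d_def[symmetric] left_diff_distrib)
qed simp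

definition end_of :: "nat \<Rightarrow> int \<Rightarrow> bool" where
  "end_of N s \<longleftrightarrow> s = 0 \<or> s = int N"

lemma end_of_interval_proj:
  assumes "K \<ge> 1" "end_of (subdivided_length K N) s"
  shows "end_of N (interval_proj K s)"
proof -
  have "(int K * int N + int K - 1) div int K = int N"
    using assms(1) by (simp add: div_eq_iff_between)
  then show ?thesis
    using assms by (auto simp: end_of_def interval_proj_def of_nat_diff)
qed

text \<open>An end of the subdivided interval lies at the outer end of its block, so all \<open>K\<close> points of that
  block are crossed on the way to another one. In general only \<open>block_distance\<close> holds, where
  \<open>K - 1\<close> is lost.\<close>

lemma end_block_distance:
  assumes "K \<ge> 1" "end_of (subdivided_length K N) s" "s' \<in> interval (subdivided_length K N)"
  shows "int K * \<bar>interval_proj K s - interval_proj K s'\<bar> \<le> \<bar>s - s'\<bar>"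
proof -
  have eq: "(int K * int N + int K - 1) div int K = int N"
    using assms(1) by (simp add: div_eq_iff_between)
  have "int K * (s' div int K) \<le> s'" "s' \<le> int K * (s' div int K) + int K - 1"
    using div_eq_iff_between[OF assms(1), of s' "s' div int K"] by auto
  moreover have "interval_proj K s' \<in> interval N" using interval_proj_in assms by blast
  moreover have "0 \<le> s'" "s' \<le> int K * int N + int K - 1"
    using assms(1,3) by (auto simp: interval_def of_nat_diff)
  ultimately show ?thesis
    using assms(1,2) eq
    by (auto simp: end_of_def interval_proj_def interval_def of_nat_diff abs_if right_diff_distrib)
qed

lemma opposite_ends_distance:
  assumes "K \<ge> 1" "end_of (subdivided_length K N) s" "end_of (subdivided_length K N) s'"
    "interval_proj K s \<noteq> interval_proj K s'"
  shows "\<bar>s - s'\<bar> = int K * \<bar>interval_proj K s - interval_proj K s'\<bar> + int K - 1"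
proof -
  have eq: "(int K * int N + int K - 1) div int K = int N"
    using assms(1) by (simp add: div_eq_iff_between)
  have nonneg: "1 \<le> int K * int N + int K"
    using assms(1) by (simp add: add_increasing)
  show ?thesis
    using assms eq nonneg
    by (auto simp: end_of_def interval_proj_def of_nat_diff abs_if)
qed

section \<open>Lifting scalar functions to a subdivided box\<close>

text \<open>The set \<open>B\<close> carries prescribed values of the lift. Off \<open>B\<close> the bounds are those of the block;
  the compatibility hypothesis compares a prescribed value with the block of any other point.\<close>

lemma short_lift_extending:
  fixes a f :: "int \<times> int \<Rightarrow> int" and k K L R :: nat
  defines "D \<equiv> interval (subdivided_length K L) \<times> interval (subdivided_length K R)"
  assumes "1 \<le> k" "k \<le> K"
    and a: "short_on (interval L \<times> interval R) a"
    and "B \<subseteq> D" and f: "short_on B f"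
    and fa: "\<And>b p. b \<in> B \<Longrightarrow> p \<in> D \<Longrightarrow>
      int k * a (block K p) - f b \<le> sup_dist b p \<and>
      f b - (int k * a (block K p) + int k - 1) \<le> sup_dist b p"
  obtains h where "short_on D h" "\<And>p. p \<in> D \<Longrightarrow> h p div int k = a (block K p)"
    "\<And>b. b \<in> B \<Longrightarrow> h b = f b"
proof -
  define lower where "lower p = (if p \<in> B then f p else int k * a (block K p))" for p
  define upper where "upper p = (if p \<in> B then f p else int k * a (block K p) + int k - 1)" for p
  have K: "K \<ge> 1" using assms by simp
  have blocks: "int k * a (block K p) - (int k * a (block K q) + int k - 1) \<le> sup_dist p q"
    if "p \<in> D" "q \<in> D" for p q
  proof -
    define d where "d = sup_dist (block K p) (block K q)"
    have "d \<ge> 0" by (simp add: d_def sup_dist_def)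
    have "int K * d \<le> sup_dist p q + int K - 1"
    proof -
      have "d = \<bar>interval_proj K (fst p) - interval_proj K (fst q)\<bar> \<or>
            d = \<bar>interval_proj K (snd p) - interval_proj K (snd q)\<bar>"
        by (auto simp: d_def sup_dist_def block_def max_def)
      then show ?thesis
        using block_distance[OF K, of "fst p" "fst q"] block_distance[OF K, of "snd p" "snd q"]
        by (auto simp: sup_dist_def)
    qed
    moreover have "a (block K p) - a (block K q) \<le> d"
      using short_onD[OF a block_in[OF K] block_in[OF K], of p q] that by (simp add: d_def D_def)
    then have "int k * (a (block K p) - a (block K q)) \<le> int k * d"
      by (intro mult_left_mono) auto
    then have "int k * a (block K p) - int k * a (block K q) \<le> int k * d"
      by (simp only: right_diff_distrib)
    moreover have "int k * d - int k \<le> int K * d - int K" if "d \<noteq> 0"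
    proof -
      have "int k * (d - 1) \<le> int K * (d - 1)"
        using that \<open>d \<ge> 0\<close> \<open>k \<le> K\<close> by (intro mult_right_mono) auto
      then show ?thesis by (simp add: right_diff_distrib)
    qed
    moreover have "sup_dist p q \<ge> 0" by (simp add: sup_dist_def)
    moreover have "int k \<ge> 1" "d = 0 \<Longrightarrow> int k * d = 0" using \<open>1 \<le> k\<close> by simp_all
    ultimately show ?thesis by linarith
  qed
  have sym: "sup_dist p q = sup_dist q p" for p q by (simp add: sup_dist_def abs_minus_commute)
  have le: "lower p - upper q \<le> sup_dist p q" if "p \<in> D" "q \<in> D" for p q
    using blocks[OF that] fa[of p q] fa[of q p] short_onD[OF f, of p q] that sym[of p q]
    by (cases "p \<in> B"; cases "q \<in> B") (simp_all add: lower_def upper_def)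
  have fin: "finite D" by (simp add: D_def interval_def)
  obtain h where h: "short_on D h" "\<And>p. p \<in> D \<Longrightarrow> lower p \<le> h p \<and> h p \<le> upper p"
    using short_extension_between[OF fin le] by blast
  have agree: "h b = f b" if "b \<in> B" for b
    using h(2)[of b] that \<open>B \<subseteq> D\<close> by (auto simp: lower_def upper_def)
  have "h p div int k = a (block K p)" if "p \<in> D" for p
  proof (cases "p \<in> B")
    case True
    then show ?thesis
      using agree[OF True] fa[OF True that] \<open>1 \<le> k\<close> by (simp add: div_eq_iff_between sup_dist_def)
  next
    case False
    then show ?thesis
      using h(2)[OF that] \<open>1 \<le> k\<close> by (simp add: div_eq_iff_between lower_def upper_def)
  qed
  with h(1) agree show ?thesis using that by blast
qed

definition frame :: "nat \<Rightarrow> nat \<Rightarrow> (int \<times> int) set" where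
  "frame N M = {p \<in> interval N \<times> interval M. end_of N (fst p) \<or> end_of M (snd p)}"

text \<open>Values are only compared along a single edge: the lifts given on opposite edges of a thin box may
  differ by more than its width.\<close>

definition short_along_edges :: "nat \<Rightarrow> nat \<Rightarrow> (int \<times> int \<Rightarrow> int) \<Rightarrow> bool" where
  "short_along_edges N M g \<longleftrightarrow>
     (\<forall>e s s'. end_of M e \<longrightarrow> s \<in> interval N \<longrightarrow> s' \<in> interval N \<longrightarrow> \<bar>g (s, e) - g (s', e)\<bar> \<le> \<bar>s - s'\<bar>) \<and>
     (\<forall>e t t'. end_of N e \<longrightarrow> t \<in> interval M \<longrightarrow> t' \<in> interval M \<longrightarrow> \<bar>g (e, t) - g (e, t')\<bar> \<le> \<bar>t - t'\<bar>)"

lemma end_of_in: "end_of N e \<Longrightarrow> e \<in> interval N"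
  by (auto simp: end_of_def interval_def)

text \<open>The values \<open>A\<close>, \<open>A'\<close> of the function to be lifted belong to a point \<open>p\<close> on an edge and to
  any point \<open>q\<close>; \<open>d1\<close>, \<open>e1\<close> measure their distance along the edge and \<open>d2\<close>, \<open>e2\<close> away from
  it, in blocks and in points. If \<open>d2 = 0\<close>, then the prescribed values on that edge compare \<open>G\<close>
  with a value \<open>G'\<close> allowed at \<open>q\<close>. If \<open>d2 > 0\<close>, the critical case is \<open>d1 > d2\<close>, since then
  the distance may be as small as \<open>3 * k * (d1 - 1) + 1\<close>; as now \<open>d1 \<ge> 2\<close>, this is still
  at least \<open>k * d1\<close>.\<close>

lemma edge_block_bound:
  fixes k A A' G G' d1 d2 e1 e2 :: int
  assumes "k \<ge> 1" and G: "k * A \<le> G" "G \<le> k * A + k - 1"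
    and A: "\<bar>A - A'\<bar> \<le> max d1 d2" and d: "d1 \<ge> 0" "d2 \<ge> 0"
    and e: "d1 \<le> e1" "3 * k * d1 \<le> e1 + 3 * k - 1" "3 * k * d2 \<le> e2"
    and same: "d2 = 0 \<Longrightarrow> k * A' \<le> G' \<and> G' \<le> k * A' + k - 1 \<and> \<bar>G - G'\<bar> \<le> d1"
  shows "k * A' - G \<le> max e1 e2 \<and> G - (k * A' + k - 1) \<le> max e1 e2"
proof (cases "d2 = 0")
  case True
  then show ?thesis using same e by linarith
next
  case False
  have "k * (A - A') \<le> k * max d1 d2" "k * (A' - A) \<le> k * max d1 d2"
    using A \<open>k \<ge> 1\<close> by (intro mult_left_mono; simp)+
  then have 1: "k * A - k * A' \<le> k * max d1 d2" "k * A' - k * A \<le> k * max d1 d2"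
    by (simp_all add: right_diff_distrib)
  have nonneg: "k * d2 \<ge> 0" using d \<open>k \<ge> 1\<close> by simp
  have "k * max d1 d2 \<le> max e1 e2"
  proof (cases "d1 \<le> d2")
    case True
    then have "k * max d1 d2 = k * d2" by (simp add: max_def)
    then show ?thesis using e(3) nonneg by linarith
  next
    case False
    with \<open>d2 \<noteq> 0\<close> d have "k * 2 \<le> k * d1" using \<open>k \<ge> 1\<close> by (intro mult_left_mono) auto
    moreover have "k * max d1 d2 = k * d1" using False by (simp add: max_def)
    ultimately show ?thesis using e(2) \<open>k \<ge> 1\<close> by linarith
  qed
  then show ?thesis using 1 G by linarith
qed

text \<open>Two prescribed values on parallel edges, in the notation of \<open>edge_block_bound\<close>. Between opposite
  edges both outer blocks are crossed entirely. The prescribed values \<open>G\<close>, \<open>G'\<close> can differ by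
  \<open>k - 1\<close> more than \<open>k * max d1 d2\<close>, for which the factor \<open>3\<close> leaves room.\<close>

lemma parallel_edges_bound:
  fixes k A A' G G' d1 d2 e1 e2 :: int
  assumes "k \<ge> 1" and G: "k * A \<le> G" "G \<le> k * A + k - 1" "k * A' \<le> G'" "G' \<le> k * A' + k - 1"
    and A: "\<bar>A - A'\<bar> \<le> max d1 d2" and d: "d1 \<ge> 0" "d2 \<ge> 0"
    and e: "d1 \<le> e1" "3 * k * d1 \<le> e1 + 3 * k - 1"
    and opposite: "d2 \<noteq> 0 \<Longrightarrow> e2 = 3 * k * d2 + 3 * k - 1"
    and same: "d2 = 0 \<Longrightarrow> \<bar>G - G'\<bar> \<le> d1"
  shows "G - G' \<le> max e1 e2"
proof (cases "d2 = 0")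
  case True
  then show ?thesis using same e by linarith
next
  case False
  have "k * (A - A') \<le> k * max d1 d2" using A \<open>k \<ge> 1\<close> by (intro mult_left_mono) auto
  then have 1: "k * A - k * A' \<le> k * max d1 d2"
    by (simp add: right_diff_distrib)
  have nonneg: "k * d2 \<ge> 0" using d \<open>k \<ge> 1\<close> by simp
  have "k * max d1 d2 + k - 1 \<le> max e1 e2"
  proof (cases "d1 \<le> d2")
    case True
    then have "k * max d1 d2 = k * d2" by (simp add: max_def)
    then show ?thesis using opposite[OF False] nonneg \<open>k \<ge> 1\<close> by linarith
  next
    case False
    with \<open>d2 \<noteq> 0\<close> d have "k * 2 \<le> k * d1" using \<open>k \<ge> 1\<close> by (intro mult_left_mono) auto
    moreover have "k * max d1 d2 = k * d1" using False by (simp add: max_def)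
    ultimately show ?thesis using e(2) \<open>k \<ge> 1\<close> by linarith
  qed
  then show ?thesis using 1 G by linarith
qed

text \<open>Two prescribed values on perpendicular edges are compared through the value \<open>C\<close> at the common
  corner.\<close>

lemma adjacent_edges_bound:
  fixes k G C G' d1 d2 e1 e2 :: int
  assumes "k \<ge> 1" "d1 \<ge> 0" "d2 \<ge> 0" "3 * k * d1 \<le> e1" "3 * k * d2 \<le> e2"
    "\<bar>G - C\<bar> \<le> d1" "\<bar>C - G'\<bar> \<le> d2"
  shows "\<bar>G - G'\<bar> \<le> max e1 e2"
proof -
  have "1 * d1 \<le> k * d1" "1 * d2 \<le> k * d2" using assms(1-3) by (intro mult_right_mono; simp)+
  then show ?thesis using assms by linarith
qed

text \<open>If a lift \<open>g\<close> is already given on the frame of the original box, then its subdivision extends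
  to a lift on the whole subdivided box. For a homotopy of based loops, \<open>g\<close> consists of the two loops
  on the horizontal edges and of the basepoint on the vertical ones.\<close>

lemma short_lift_rel_frame:
  fixes a g :: "int \<times> int \<Rightarrow> int" and k K L R :: nat
  defines "N \<equiv> subdivided_length K L" and "M \<equiv> subdivided_length K R"
  assumes "1 \<le> k" and K: "K = 3 * k"
    and a: "short_on (interval L \<times> interval R) a"
    and g: "short_along_edges L R g" and ga: "\<And>x. x \<in> frame L R \<Longrightarrow> g x div int k = a x"
  obtains h where "short_on (interval N \<times> interval M) h"
    "\<And>p. p \<in> interval N \<times> interval M \<Longrightarrow> h p div int k = a (block K p)"
    "\<And>p. p \<in> frame N M \<Longrightarrow> h p = g (block K p)"
proof -
  have K1: "1 \<le> K" using \<open>1 \<le> k\<close> K by simp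
  have k1: "int k \<ge> 1" using \<open>1 \<le> k\<close> by simp
  have Kk: "int K = 3 * int k" using K by simp
  let ?\<rho> = "interval_proj K"
  have ends: "end_of L (?\<rho> s)" if "end_of N s" for s
    using end_of_interval_proj[OF K1] that N_def by blast
  have ends': "end_of R (?\<rho> t)" if "end_of M t" for t
    using end_of_interval_proj[OF K1] that M_def by blast
  have into: "?\<rho> s \<in> interval L" if "s \<in> interval N" for s
    using interval_proj_in[OF K1] that N_def by blast
  have into': "?\<rho> t \<in> interval R" if "t \<in> interval M" for t
    using interval_proj_in[OF K1] that M_def by blast
  have gb: "int k * a x \<le> g x" "g x \<le> int k * a x + int k - 1" if "x \<in> frame L R" for x
    using ga[OF that] \<open>1 \<le> k\<close> by (simp_all add: div_eq_iff_between)
  have frame_h: "(s, e) \<in> frame L R" if "s \<in> interval L" "end_of R e" for s e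
    using that end_of_in by (auto simp: frame_def)
  have frame_v: "(e, t) \<in> frame L R" if "t \<in> interval R" "end_of L e" for t e
    using that end_of_in by (auto simp: frame_def)
  have a_short: "\<bar>a (x, y) - a (x', y')\<bar> \<le> max \<bar>x - x'\<bar> \<bar>y - y'\<bar>"
    if "x \<in> interval L" "x' \<in> interval L" "y \<in> interval R" "y' \<in> interval R" for x x' y y'
    using short_onD[OF a, of "(x, y)" "(x', y')"] that by (simp add: sup_dist_def)
  have g_h: "\<bar>g (x, e) - g (x', e)\<bar> \<le> \<bar>x - x'\<bar>"
    if "x \<in> interval L" "x' \<in> interval L" "end_of R e" for x x' e
    using g that by (simp add: short_along_edges_def)
  have g_v: "\<bar>g (e, y) - g (e, y')\<bar> \<le> \<bar>y - y'\<bar>"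
    if "y \<in> interval R" "y' \<in> interval R" "end_of L e" for y y' e
    using g that by (simp add: short_along_edges_def)
  \<comment> \<open>The second form serves vertical edges, where the coordinates exchange their roles.\<close>
  have sd: "sup_dist (s, t) (s', t') = max \<bar>s - s'\<bar> \<bar>t - t'\<bar>"
    "sup_dist (s, t) (s', t') = max \<bar>t - t'\<bar> \<bar>s - s'\<bar>" for s t s' t'
    by (auto simp: sup_dist_def)
  note near = interval_proj_short[OF K1] block_distance[OF K1, unfolded Kk]
  note far = end_block_distance[OF K1, of L, folded N_def, unfolded Kk]
    end_block_distance[OF K1, of R, folded M_def, unfolded Kk]
  note opp = opposite_ends_distance[OF K1, of L, folded N_def, unfolded Kk]
    opposite_ends_distance[OF K1, of R, folded M_def, unfolded Kk]
  have fa: "int k * a (block K q) - g (block K p) \<le> sup_dist p q \<and>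
      g (block K p) - (int k * a (block K q) + int k - 1) \<le> sup_dist p q"
    if p: "p \<in> frame N M" and q: "q \<in> interval N \<times> interval M" for p q
  proof -
    obtain s t s' t' where eq: "p = (s, t)" "q = (s', t')" by fastforce
    have m: "s \<in> interval N" "t \<in> interval M" "s' \<in> interval N" "t' \<in> interval M"
      and en: "end_of N s \<or> end_of M t"
      using p q by (auto simp: eq frame_def)
    note i = into[OF m(1)] into'[OF m(2)] into[OF m(3)] into'[OF m(4)]
    from en show ?thesis
    proof
      assume e: "end_of N s"
      note e' = ends[OF e]
      show ?thesis
        unfolding eq sd(2) block_def map_prod_simp
      proof (rule edge_block_bound[OF k1, where G' = "g (?\<rho> s, ?\<rho> t')"])
        show "\<bar>a (?\<rho> s, ?\<rho> t) - a (?\<rho> s', ?\<rho> t')\<bar> \<le> max \<bar>?\<rho> t - ?\<rho> t'\<bar> \<bar>?\<rho> s - ?\<rho> s'\<bar>"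
          using a_short[of "?\<rho> s" "?\<rho> s'" "?\<rho> t" "?\<rho> t'"] i by (simp add: max.commute)
        show "int k * a (?\<rho> s', ?\<rho> t') \<le> g (?\<rho> s, ?\<rho> t') \<and>
          g (?\<rho> s, ?\<rho> t') \<le> int k * a (?\<rho> s', ?\<rho> t') + int k - 1 \<and>
          \<bar>g (?\<rho> s, ?\<rho> t) - g (?\<rho> s, ?\<rho> t')\<bar> \<le> \<bar>?\<rho> t - ?\<rho> t'\<bar>"
          if "\<bar>?\<rho> s - ?\<rho> s'\<bar> = 0"
          using that gb[OF frame_v[OF i(4) e']] g_v[OF i(2,4) e'] by simp
      qed (use near[of t t'] far(1)[OF e m(3)] gb[OF frame_v[OF i(2) e']] in simp_all)
    next
      assume e: "end_of M t"
      note e' = ends'[OF e]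
      show ?thesis
        unfolding eq sd(1) block_def map_prod_simp
      proof (rule edge_block_bound[OF k1, where G' = "g (?\<rho> s', ?\<rho> t)"])
        show "\<bar>a (?\<rho> s, ?\<rho> t) - a (?\<rho> s', ?\<rho> t')\<bar> \<le> max \<bar>?\<rho> s - ?\<rho> s'\<bar> \<bar>?\<rho> t - ?\<rho> t'\<bar>"
          using a_short i by simp
        show "int k * a (?\<rho> s', ?\<rho> t') \<le> g (?\<rho> s', ?\<rho> t) \<and>
          g (?\<rho> s', ?\<rho> t) \<le> int k * a (?\<rho> s', ?\<rho> t') + int k - 1 \<and>
          \<bar>g (?\<rho> s, ?\<rho> t) - g (?\<rho> s', ?\<rho> t)\<bar> \<le> \<bar>?\<rho> s - ?\<rho> s'\<bar>"
          if "\<bar>?\<rho> t - ?\<rho> t'\<bar> = 0"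
          using that gb[OF frame_h[OF i(3) e']] g_h[OF i(1,3) e'] by simp
      qed (use near[of s s'] far(2)[OF e m(4)] gb[OF frame_h[OF i(1) e']] in simp_all)
    qed
  qed
  have f: "short_on (frame N M) (\<lambda>p. g (block K p))"
    unfolding short_on_def
  proof (intro ballI)
    fix p q assume pq: "p \<in> frame N M" "q \<in> frame N M"
    obtain s t s' t' where eq: "p = (s, t)" "q = (s', t')" by fastforce
    have m: "s \<in> interval N" "t \<in> interval M" "s' \<in> interval N" "t' \<in> interval M"
      using pq by (auto simp: eq frame_def)
    note i = into[OF m(1)] into'[OF m(2)] into[OF m(3)] into'[OF m(4)]
    have A: "\<bar>a (?\<rho> s, ?\<rho> t) - a (?\<rho> s', ?\<rho> t')\<bar> \<le> max \<bar>?\<rho> s - ?\<rho> s'\<bar> \<bar>?\<rho> t - ?\<rho> t'\<bar>"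
      using a_short i by simp
    consider "end_of N s" "end_of N s'" | "end_of M t" "end_of M t'"
      | "end_of N s" "end_of M t'" | "end_of M t" "end_of N s'"
      using pq by (auto simp: eq frame_def)
    then show "g (block K p) - g (block K q) \<le> sup_dist p q"
    proof cases
      case 1
      note e = ends[OF 1(1)] ends[OF 1(2)]
      show ?thesis
        unfolding eq sd(2) block_def map_prod_simp
      proof (rule parallel_edges_bound[OF k1])
        show "\<bar>a (?\<rho> s, ?\<rho> t) - a (?\<rho> s', ?\<rho> t')\<bar> \<le> max \<bar>?\<rho> t - ?\<rho> t'\<bar> \<bar>?\<rho> s - ?\<rho> s'\<bar>"
          using A by (simp add: max.commute)
      qed (use near[of t t'] opp(1)[OF 1] gb[OF frame_v[OF i(2) e(1)]] gb[OF frame_v[OF i(4) e(2)]]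
          g_v[OF i(2,4) e(2)] in simp_all)
    next
      case 2
      note e = ends'[OF 2(1)] ends'[OF 2(2)]
      show ?thesis
        unfolding eq sd(1) block_def map_prod_simp
        by (rule parallel_edges_bound[OF k1 _ _ _ _ A])
          (use near[of s s'] opp(2)[OF 2] gb[OF frame_h[OF i(1) e(1)]] gb[OF frame_h[OF i(3) e(2)]]
          g_h[OF i(1,3) e(2)] in simp_all)
    next
      case 3
      note e = ends[OF 3(1)] ends'[OF 3(2)]
      have "\<bar>g (?\<rho> s, ?\<rho> t) - g (?\<rho> s', ?\<rho> t')\<bar> \<le> max \<bar>t - t'\<bar> \<bar>s - s'\<bar>"
        using adjacent_edges_bound[OF k1 abs_ge_zero abs_ge_zero _ _ g_v[OF i(2,4) e(1)] g_h[OF i(1,3) e(2)]]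
          far(1)[OF 3(1) m(3)] far(2)[OF 3(2) m(2)] by (simp add: abs_minus_commute)
      then show ?thesis unfolding eq sd(2) block_def map_prod_simp by linarith
    next
      case 4
      note e = ends'[OF 4(1)] ends[OF 4(2)]
      have "\<bar>g (?\<rho> s, ?\<rho> t) - g (?\<rho> s', ?\<rho> t')\<bar> \<le> max \<bar>s - s'\<bar> \<bar>t - t'\<bar>"
        using adjacent_edges_bound[OF k1 abs_ge_zero abs_ge_zero _ _ g_h[OF i(1,3) e(1)] g_v[OF i(2,4) e(2)]]
          far(2)[OF 4(1) m(4)] far(1)[OF 4(2) m(1)] by (simp add: abs_minus_commute)
      then show ?thesis unfolding eq sd(1) block_def map_prod_simp by linarith
    qed
  qed
  have "frame N M \<subseteq> interval N \<times> interval M" by (auto simp: frame_def)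
  moreover have "k \<le> K" using K by simp
  ultimately show ?thesis
    using short_lift_extending[OF \<open>1 \<le> k\<close> \<open>k \<le> K\<close> a, folded N_def M_def, OF _ f fa] that
    by blast
qed

section \<open>Homotopy and subdivision of loops\<close>

lemma digitally_continuous_compose:
  "digitally_continuous X Y f \<Longrightarrow> digitally_continuous Y Z g \<Longrightarrow> digitally_continuous X Z (g \<circ> f)"
  unfolding digitally_continuous_def image_subset_iff o_apply by blast

lemma digitally_continuous_interval_proj:
  assumes "K \<ge> 1"
  shows "digitally_continuous (interval (subdivided_length K N)) (interval N) (interval_proj K)"
  unfolding digitally_continuous_def adjacent_int_def image_subset_iff
  using interval_proj_in[OF assms] order_trans[OF interval_proj_short[OF assms]] by blast

lemma interval_proj_interval_proj: "interval_proj k (interval_proj m s) = interval_proj (k * m) s"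
  using zdiv_zmult2_eq[of "int k" s "int m"] by (simp add: interval_proj_def mult.commute)

lemma interval_proj_0: "interval_proj K 0 = 0"
  by (simp add: interval_proj_def)

lemma interval_proj_last: "K \<ge> 1 \<Longrightarrow> interval_proj K (int (subdivided_length K N)) = int N"
  by (simp add: interval_proj_def of_nat_diff div_eq_iff_between)

lemma subdivided_length_Suc: "k \<ge> 1 \<Longrightarrow> subdivided_length k N + 1 = k * (N + 1)"
  by simp

lemma subdivided_length_mult:
  assumes "k \<ge> 1" "m \<ge> 1"
  shows "subdivided_length m (subdivided_length k N) = subdivided_length (k * m) N"
proof -
  have "subdivided_length m (subdivided_length k N) + 1 = m * (subdivided_length k N + 1)"
    using assms(2) by (rule subdivided_length_Suc)
  also have "\<dots> = m * (k * (N + 1))"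
    using subdivided_length_Suc[OF assms(1)] by (rule arg_cong)
  also have "\<dots> = k * m * (N + 1)"
    by (simp only: ac_simps)
  also have "\<dots> = subdivided_length (k * m) N + 1"
    using assms by (intro subdivided_length_Suc[symmetric]) simp
  finally show ?thesis by (simp only: add_right_cancel)
qed

lemma subdivided_length_eq_iff:
  assumes "k \<ge> 1" "l \<ge> 1"
  shows "subdivided_length k M = subdivided_length l N \<longleftrightarrow> k * (M + 1) = l * (N + 1)"
  unfolding subdivided_length_Suc[OF assms(1), symmetric] subdivided_length_Suc[OF assms(2), symmetric]
  by (simp only: add_right_cancel)

lemma subdivided_loop:
  assumes "(N, \<gamma>) \<in> based_loops Y y0" "K \<ge> 1"
  shows "(subdivided_length K N, \<gamma> \<circ> interval_proj K) \<in> based_loops Y y0"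
proof -
  have "1 * N \<le> K * N" using assms(2) by (rule mult_right_mono) simp
  moreover have "N \<ge> 1" using assms by (auto simp: based_loops_def)
  ultimately have "subdivided_length K N \<ge> 1" using assms(2) by linarith
  moreover have "digitally_continuous (interval (subdivided_length K N)) Y (\<gamma> \<circ> interval_proj K)"
    using assms digitally_continuous_compose[OF digitally_continuous_interval_proj[OF assms(2)], of N Y \<gamma>]
    by (simp add: based_loops_def)
  ultimately show ?thesis
    using assms interval_proj_last[OF assms(2), of N]
    by (simp add: based_loops_def interval_proj_0)
qed

lemma based_homotopicI:
  assumes "R \<ge> 1" "digitally_continuous (interval M \<times> interval R) Y H"
    "\<And>s. s \<in> interval M \<Longrightarrow> H (s, 0) = \<alpha> s" "\<And>s. s \<in> interval M \<Longrightarrow> H (s, int R) = \<beta> s"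
    "\<And>t. t \<in> interval R \<Longrightarrow> H (0, t) = y0" "\<And>t. t \<in> interval R \<Longrightarrow> H (int M, t) = y0"
  shows "based_homotopic Y y0 M \<alpha> \<beta>"
  using assms unfolding based_homotopic_def by blast

lemma based_homotopicE:
  assumes "based_homotopic Y y0 M \<alpha> \<beta>"
  obtains R H where "R \<ge> 1" "digitally_continuous (interval M \<times> interval R) Y H"
    "\<And>s. s \<in> interval M \<Longrightarrow> H (s, 0) = \<alpha> s" "\<And>s. s \<in> interval M \<Longrightarrow> H (s, int R) = \<beta> s"
    "\<And>t. t \<in> interval R \<Longrightarrow> H (0, t) = y0" "\<And>t. t \<in> interval R \<Longrightarrow> H (int M, t) = y0"
  using assms unfolding based_homotopic_def by blast

lemma based_homotopic_of_agree:
  assumes "(M, \<alpha>) \<in> based_loops Y y0" "\<And>s. s \<in> interval M \<Longrightarrow> \<alpha> s = \<beta> s"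
  shows "based_homotopic Y y0 M \<alpha> \<beta>"
proof (rule based_homotopicI[where R = 1 and H = "\<alpha> \<circ> fst"])
  show "digitally_continuous (interval M \<times> interval 1) Y (\<alpha> \<circ> fst)"
    using assms(1) by (auto simp: based_loops_def digitally_continuous_def adjacent_prod_def)
qed (use assms in \<open>auto simp: based_loops_def\<close>)

lemma based_homotopic_sym:
  assumes "based_homotopic Y y0 M \<alpha> \<beta>"
  shows "based_homotopic Y y0 M \<beta> \<alpha>"
proof -
  obtain R H where H: "R \<ge> 1" "digitally_continuous (interval M \<times> interval R) Y H"
    "\<And>s. s \<in> interval M \<Longrightarrow> H (s, 0) = \<alpha> s" "\<And>s. s \<in> interval M \<Longrightarrow> H (s, int R) = \<beta> s"
    "\<And>t. t \<in> interval R \<Longrightarrow> H (0, t) = y0" "\<And>t. t \<in> interval R \<Longrightarrow> H (int M, t) = y0"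
    using assms by (rule based_homotopicE) blast
  have rev: "digitally_continuous (interval M \<times> interval R) (interval M \<times> interval R) (map_prod id (\<lambda>t. int R - t))"
    by (auto simp: digitally_continuous_def adjacent_prod_def adjacent_int_def interval_def)
  show ?thesis
    by (rule based_homotopicI[OF H(1) digitally_continuous_compose[OF rev H(2)]])
      (use H(3-6) in \<open>simp_all add: interval_def\<close>)
qed

text \<open>The two homotopies are stacked so that they share the row of \<open>\<beta>\<close>; adjacent points then always
  lie in the domain of one of them.\<close>

lemma based_homotopic_trans:
  assumes "based_homotopic Y y0 M \<alpha> \<beta>" "based_homotopic Y y0 M \<beta> \<delta>"
  shows "based_homotopic Y y0 M \<alpha> \<delta>"
proof -
  obtain R H where H: "R \<ge> 1" "digitally_continuous (interval M \<times> interval R) Y H"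
    "\<And>s. s \<in> interval M \<Longrightarrow> H (s, 0) = \<alpha> s" "\<And>s. s \<in> interval M \<Longrightarrow> H (s, int R) = \<beta> s"
    "\<And>t. t \<in> interval R \<Longrightarrow> H (0, t) = y0" "\<And>t. t \<in> interval R \<Longrightarrow> H (int M, t) = y0"
    using assms(1) by (rule based_homotopicE) blast
  obtain R' H' where H': "R' \<ge> 1" "digitally_continuous (interval M \<times> interval R') Y H'"
    "\<And>s. s \<in> interval M \<Longrightarrow> H' (s, 0) = \<beta> s" "\<And>s. s \<in> interval M \<Longrightarrow> H' (s, int R') = \<delta> s"
    "\<And>t. t \<in> interval R' \<Longrightarrow> H' (0, t) = y0" "\<And>t. t \<in> interval R' \<Longrightarrow> H' (int M, t) = y0"
    using assms(2) by (rule based_homotopicE) blast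
  define G where "G p = (if snd p \<le> int R then H p else H' (fst p, snd p - int R))" for p
  have upper: "G (s, t) = H' (s, t - int R)" if "s \<in> interval M" "t \<ge> int R" for s t
    using that H(4)[of s] H'(3)[of s] by (auto simp: G_def)
  have cont: "digitally_continuous (interval M \<times> interval (R + R')) Y G"
    unfolding digitally_continuous_def
  proof (intro conjI ballI impI)
    show "G ` (interval M \<times> interval (R + R')) \<subseteq> Y"
      using H(2) H'(2) unfolding digitally_continuous_def
      by (auto simp: G_def interval_def image_subset_iff)
    fix p q
    assume p: "p \<in> interval M \<times> interval (R + R')" and q: "q \<in> interval M \<times> interval (R + R')"
      and "adjacent p q"
    obtain s t s' t' where eq: "p = (s, t)" "q = (s', t')" by fastforce
    have adj: "\<bar>s - s'\<bar> \<le> 1" "\<bar>t - t'\<bar> \<le> 1"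
      using \<open>adjacent p q\<close> by (auto simp: eq adjacent_prod_def adjacent_int_def)
    consider "t \<le> int R" "t' \<le> int R" | "t \<ge> int R" "t' \<ge> int R" using adj by linarith
    then show "adjacent (G p) (G q)"
    proof cases
      case 1
      then have "p \<in> interval M \<times> interval R" "q \<in> interval M \<times> interval R"
        using p q by (auto simp: eq interval_def)
      then have "adjacent (H p) (H q)"
        using H(2) \<open>adjacent p q\<close> by (auto simp: digitally_continuous_def)
      then show ?thesis using 1 by (simp add: G_def eq)
    next
      case 2
      have "(s, t - int R) \<in> interval M \<times> interval R'" "(s', t' - int R) \<in> interval M \<times> interval R'"
        using 2 p q by (auto simp: eq interval_def)
      moreover have "adjacent (s, t - int R) (s', t' - int R)"
        using adj by (simp add: adjacent_prod_def adjacent_int_def)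
      ultimately have "adjacent (H' (s, t - int R)) (H' (s', t' - int R))"
        using H'(2) unfolding digitally_continuous_def by blast
      then show ?thesis using 2 p q by (simp add: eq upper)
    qed
  qed
  show ?thesis
  proof (rule based_homotopicI[OF _ cont])
    fix s assume "s \<in> interval M"
    then show "G (s, 0) = \<alpha> s" "G (s, int (R + R')) = \<delta> s"
      using H(1) H(3)[of s] H'(4)[of s] upper[of s "int (R + R')"] by (simp_all add: G_def)
  next
    fix t assume "t \<in> interval (R + R')"
    then show "G (0, t) = y0" "G (int M, t) = y0"
      using H(5,6)[of t] H'(5,6)[of "t - int R"] by (auto simp: G_def interval_def)
  qed (use H(1) in simp)
qed

lemma based_homotopic_subdivide:
  assumes "based_homotopic Y y0 M \<alpha> \<beta>" "K \<ge> 1"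
  shows "based_homotopic Y y0 (subdivided_length K M) (\<alpha> \<circ> interval_proj K) (\<beta> \<circ> interval_proj K)"
proof -
  obtain R H where H: "R \<ge> 1" "digitally_continuous (interval M \<times> interval R) Y H"
    "\<And>s. s \<in> interval M \<Longrightarrow> H (s, 0) = \<alpha> s" "\<And>s. s \<in> interval M \<Longrightarrow> H (s, int R) = \<beta> s"
    "\<And>t. t \<in> interval R \<Longrightarrow> H (0, t) = y0" "\<And>t. t \<in> interval R \<Longrightarrow> H (int M, t) = y0"
    using assms(1) by (rule based_homotopicE) blast
  have sub: "digitally_continuous (interval (subdivided_length K M) \<times> interval R) (interval M \<times> interval R)
      (map_prod (interval_proj K) id)"
    using digitally_continuous_interval_proj[OF assms(2), of M]
    by (fastforce simp: digitally_continuous_def adjacent_prod_def)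
  show ?thesis
    by (rule based_homotopicI[OF H(1) digitally_continuous_compose[OF sub H(2)]])
      (simp_all add: H(3-6) interval_proj_in[OF assms(2)] interval_proj_last[OF assms(2)] interval_proj_0
        del: One_nat_def)
qed

lemma based_homotopic_push:
  assumes "based_homotopic X x0 M \<alpha> \<beta>" "digitally_continuous X Y f" "f x0 = y0"
  shows "based_homotopic Y y0 M (f \<circ> \<alpha>) (f \<circ> \<beta>)"
proof -
  obtain R H where H: "R \<ge> 1" "digitally_continuous (interval M \<times> interval R) X H"
    "\<And>s. s \<in> interval M \<Longrightarrow> H (s, 0) = \<alpha> s" "\<And>s. s \<in> interval M \<Longrightarrow> H (s, int R) = \<beta> s"
    "\<And>t. t \<in> interval R \<Longrightarrow> H (0, t) = x0" "\<And>t. t \<in> interval R \<Longrightarrow> H (int M, t) = x0"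
    using assms(1) by (rule based_homotopicE) blast
  show ?thesis
    by (rule based_homotopicI[OF H(1) digitally_continuous_compose[OF H(2) assms(2)]])
      (simp_all add: H(3-6) assms(3))
qed

lemma loop_relI:
  assumes "(M, \<alpha>) \<in> based_loops Y y0" "(N, \<beta>) \<in> based_loops Y y0" "k \<ge> 1" "l \<ge> 1"
    "subdivided_length k M = subdivided_length l N"
    "based_homotopic Y y0 (subdivided_length k M) (\<alpha> \<circ> interval_proj k) (\<beta> \<circ> interval_proj l)"
  shows "((M, \<alpha>), (N, \<beta>)) \<in> loop_rel Y y0"
  using assms subdivided_length_eq_iff[of k l M N] unfolding loop_rel_def by blast

lemma loop_relE:
  assumes "((M, \<alpha>), (N, \<beta>)) \<in> loop_rel Y y0"
  obtains k l where "(M, \<alpha>) \<in> based_loops Y y0" "(N, \<beta>) \<in> based_loops Y y0" "k \<ge> 1" "l \<ge> 1"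
    "subdivided_length k M = subdivided_length l N"
    "based_homotopic Y y0 (subdivided_length k M) (\<alpha> \<circ> interval_proj k) (\<beta> \<circ> interval_proj l)"
  using assms unfolding loop_rel_def
  by (auto simp del: One_nat_def simp: subdivided_length_eq_iff)

lemma interval_proj_1 [simp]: "interval_proj 1 = id" "interval_proj (Suc 0) = id"
  by (auto simp: interval_proj_def fun_eq_iff)

lemma loop_rel_agree:
  assumes "(M, \<alpha>) \<in> based_loops Y y0" "(M, \<beta>) \<in> based_loops Y y0"
    "\<And>s. s \<in> interval M \<Longrightarrow> \<alpha> s = \<beta> s"
  shows "((M, \<alpha>), (M, \<beta>)) \<in> loop_rel Y y0"
  using loop_relI[of M \<alpha> Y y0 M \<beta> 1 1] based_homotopic_of_agree[OF assms(1,3)] assms(1,2) by simp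

text \<open>For transitivity, the homotopies that relate \<open>\<alpha>\<close> to \<open>\<beta>\<close> and \<open>\<beta>\<close> to \<open>\<delta>\<close> involve
  different subdivisions of \<open>\<beta>\<close>. Subdividing each of them by the factor of the other one makes
  them meet in the same subdivision of \<open>\<beta>\<close>.\<close>

lemma equiv_loop_rel: "equiv (based_loops Y y0) (loop_rel Y y0)"
proof (rule equivI)
  show "loop_rel Y y0 \<subseteq> based_loops Y y0 \<times> based_loops Y y0"
    by (auto simp: loop_rel_def)
  show "refl_on (based_loops Y y0) (loop_rel Y y0)"
    using loop_rel_agree by (fastforce simp: refl_on_def)
  show "sym (loop_rel Y y0)"
  proof (rule symI)
    fix p q assume pq: "(p, q) \<in> loop_rel Y y0"
    obtain M \<alpha> N \<beta> where eq: "p = (M, \<alpha>)" "q = (N, \<beta>)" by fastforce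
    show "(q, p) \<in> loop_rel Y y0"
      using pq unfolding eq by (elim loop_relE) (metis based_homotopic_sym loop_relI)
  qed
  show "trans (loop_rel Y y0)"
  proof (rule transI)
    fix p q r assume "(p, q) \<in> loop_rel Y y0" "(q, r) \<in> loop_rel Y y0"
    moreover obtain M \<alpha> N \<beta> P \<delta> where eq: "p = (M, \<alpha>)" "q = (N, \<beta>)" "r = (P, \<delta>)" by (metis surj_pair)
    ultimately have pq: "((M, \<alpha>), (N, \<beta>)) \<in> loop_rel Y y0" and qr: "((N, \<beta>), (P, \<delta>)) \<in> loop_rel Y y0"
      by simp_all
    obtain k l where 1: "(M, \<alpha>) \<in> based_loops Y y0" "k \<ge> 1" "l \<ge> 1"
        "subdivided_length k M = subdivided_length l N"
        "based_homotopic Y y0 (subdivided_length k M) (\<alpha> \<circ> interval_proj k) (\<beta> \<circ> interval_proj l)"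
      using pq by (rule loop_relE)
    obtain m n where 2: "(P, \<delta>) \<in> based_loops Y y0" "m \<ge> 1" "n \<ge> 1"
        "subdivided_length m N = subdivided_length n P"
        "based_homotopic Y y0 (subdivided_length m N) (\<beta> \<circ> interval_proj m) (\<delta> \<circ> interval_proj n)"
      using qr by (rule loop_relE)
    have comp: "(\<gamma> \<circ> interval_proj i) \<circ> interval_proj j = \<gamma> \<circ> interval_proj (i * j)"
      for \<gamma> :: "int \<Rightarrow> 'a" and i j
      by (auto simp: interval_proj_interval_proj)
    have len: "subdivided_length (k * m) M = subdivided_length (l * m) N"
      "subdivided_length (m * l) N = subdivided_length (n * l) P"
      using 1(2-4) 2(2-4) subdivided_length_mult by metis+
    have "based_homotopic Y y0 (subdivided_length (k * m) M)
        (\<alpha> \<circ> interval_proj (k * m)) (\<beta> \<circ> interval_proj (l * m))"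
      using based_homotopic_subdivide[OF 1(5) 2(2)] 1(2) 2(2)
      by (simp only: comp subdivided_length_mult)
    moreover have "based_homotopic Y y0 (subdivided_length (m * l) N)
        (\<beta> \<circ> interval_proj (m * l)) (\<delta> \<circ> interval_proj (n * l))"
      using based_homotopic_subdivide[OF 2(5) 1(3)] 1(3) 2(2)
      by (simp only: comp subdivided_length_mult)
    ultimately have "based_homotopic Y y0 (subdivided_length (k * m) M)
        (\<alpha> \<circ> interval_proj (k * m)) (\<delta> \<circ> interval_proj (n * l))"
      using len by (metis based_homotopic_trans mult.commute)
    moreover have "subdivided_length (k * m) M = subdivided_length (n * l) P"
      using len by (metis mult.commute)
    moreover have "k * m \<ge> 1" "n * l \<ge> 1" using 1 2 by simp_all
    ultimately show "(p, r) \<in> loop_rel Y y0"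
      unfolding eq using 1(1) 2(1) by (intro loop_relI)
  qed
qed

lemma loop_relD: "(p, q) \<in> loop_rel Y y0 \<Longrightarrow> p \<in> based_loops Y y0 \<and> q \<in> based_loops Y y0"
  by (auto simp: loop_rel_def)

lemma loop_rel_refl: "p \<in> based_loops Y y0 \<Longrightarrow> (p, p) \<in> loop_rel Y y0"
  using equiv_loop_rel[of Y y0] by (meson equivE refl_onD)

lemma loop_rel_sym: "(p, q) \<in> loop_rel Y y0 \<Longrightarrow> (q, p) \<in> loop_rel Y y0"
  using equiv_loop_rel[of Y y0] by (meson equivE symE)

lemma loop_rel_trans: "(p, q) \<in> loop_rel Y y0 \<Longrightarrow> (q, r) \<in> loop_rel Y y0 \<Longrightarrow> (p, r) \<in> loop_rel Y y0"
  using equiv_loop_rel[of Y y0] by (meson equivE transE)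

lemma loop_rel_subdivided:
  assumes "(N, \<gamma>) \<in> based_loops Y y0" "K \<ge> 1"
  shows "((N, \<gamma>), (subdivided_length K N, \<gamma> \<circ> interval_proj K)) \<in> loop_rel Y y0"
  using assms subdivided_loop[OF assms]
  by (intro loop_relI[of _ _ _ _ _ _ K 1]) (auto intro: based_homotopic_of_agree)

section \<open>Induced maps and concatenation\<close>

definition map_loop :: "('a \<Rightarrow> 'b) \<Rightarrow> 'a loop \<Rightarrow> 'b loop" where
  "map_loop f p = (fst p, f \<circ> snd p)"

lemma map_loop_in:
  assumes "p \<in> based_loops X x0" "digitally_continuous X Y f" "f x0 = y0"
  shows "map_loop f p \<in> based_loops Y y0"
proof -
  have "digitally_continuous (interval (fst p)) X (snd p)"
    using assms(1) by (auto simp: based_loops_def)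
  from digitally_continuous_compose[OF this assms(2)] show ?thesis
    using assms by (auto simp: based_loops_def map_loop_def)
qed

lemma loop_rel_push:
  assumes "(p, q) \<in> loop_rel X x0" and f: "digitally_continuous X Y f" "f x0 = y0"
  shows "(map_loop f p, map_loop f q) \<in> loop_rel Y y0"
proof -
  obtain M \<alpha> N \<beta> where eq: "p = (M, \<alpha>)" "q = (N, \<beta>)" by fastforce
  obtain k l where kl: "(M, \<alpha>) \<in> based_loops X x0" "(N, \<beta>) \<in> based_loops X x0" "k \<ge> 1" "l \<ge> 1"
    "subdivided_length k M = subdivided_length l N"
    "based_homotopic X x0 (subdivided_length k M) (\<alpha> \<circ> interval_proj k) (\<beta> \<circ> interval_proj l)"
    using assms(1) unfolding eq by (rule loop_relE)
  have "based_homotopic Y y0 (subdivided_length k M) ((f \<circ> \<alpha>) \<circ> interval_proj k) ((f \<circ> \<beta>) \<circ> interval_proj l)"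
    using based_homotopic_push[OF kl(6) f] by (simp add: comp_assoc)
  then show ?thesis
    using map_loop_in[OF kl(1) f] map_loop_in[OF kl(2) f] kl(3-5)
    unfolding eq map_loop_def fst_conv snd_conv by (intro loop_relI)
qed

lemma induced_map_alt: "induced_map Y y0 f A = (\<Union>p\<in>A. loop_rel Y y0 `` {map_loop f p})"
  by (simp add: induced_map_def map_loop_def)

lemma mem_induced_map: "q \<in> induced_map Y y0 f A \<longleftrightarrow> (\<exists>p\<in>A. (map_loop f p, q) \<in> loop_rel Y y0)"
  by (auto simp: induced_map_alt)

lemma induced_map_class:
  assumes "p \<in> based_loops X x0" "digitally_continuous X Y f" "f x0 = y0"
  shows "induced_map Y y0 f (loop_rel X x0 `` {p}) = loop_rel Y y0 `` {map_loop f p}"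
proof -
  have "loop_rel Y y0 `` {map_loop f q} = loop_rel Y y0 `` {map_loop f p}"
    if "q \<in> loop_rel X x0 `` {p}" for q
    using equiv_class_eq[OF equiv_loop_rel] loop_rel_push[OF _ assms(2,3)] that by blast
  moreover have "p \<in> loop_rel X x0 `` {p}"
    using equiv_class_self[OF equiv_loop_rel assms(1)] .
  ultimately show ?thesis unfolding induced_map_alt by blast
qed

lemma loop_concat_in:
  assumes "p \<in> based_loops Y y0" "q \<in> based_loops Y y0"
  shows "loop_concat p q \<in> based_loops Y y0"
proof -
  obtain M \<alpha> N \<beta> where eq: "p = (M, \<alpha>)" "q = (N, \<beta>)" by fastforce
  have \<alpha>: "digitally_continuous (interval M) Y \<alpha>" "\<alpha> 0 = y0" "\<alpha> (int M) = y0" "M \<ge> 1"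
    and \<beta>: "digitally_continuous (interval N) Y \<beta>" "\<beta> 0 = y0" "\<beta> (int N) = y0"
    using assms by (auto simp: eq based_loops_def)
  define \<gamma> where "\<gamma> t = (if t \<le> int M then \<alpha> t else \<beta> (t - (int M + 1)))" for t
  have adj0: "adjacent y0 y0"
    using \<alpha> by (force simp: digitally_continuous_def interval_def adjacent_int_def)
  have "digitally_continuous (interval (M + N + 1)) Y \<gamma>"
    unfolding digitally_continuous_def
  proof (intro conjI ballI impI)
    show "\<gamma> ` interval (M + N + 1) \<subseteq> Y"
      using \<alpha>(1) \<beta>(1) unfolding digitally_continuous_def
      by (auto simp: \<gamma>_def interval_def image_subset_iff)
    fix s t assume st: "s \<in> interval (M + N + 1)" "t \<in> interval (M + N + 1)" "adjacent s t"
    have d: "\<bar>s - t\<bar> \<le> 1" using st(3) by (simp add: adjacent_int_def)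
    consider "s \<le> int M" "t \<le> int M" | "s > int M" "t > int M"
      | "s = int M" "t = int M + 1" | "t = int M" "s = int M + 1" using d by linarith
    then show "adjacent (\<gamma> s) (\<gamma> t)"
    proof cases
      case 1
      then show ?thesis
        using \<alpha>(1) st by (auto simp: digitally_continuous_def \<gamma>_def interval_def)
    next
      case 2
      have "s - (int M + 1) \<in> interval N" "t - (int M + 1) \<in> interval N"
        "adjacent (s - (int M + 1)) (t - (int M + 1))"
        using 2 st d by (auto simp: interval_def adjacent_int_def)
      then have "adjacent (\<beta> (s - (int M + 1))) (\<beta> (t - (int M + 1)))"
        using \<beta>(1) unfolding digitally_continuous_def by blast
      then show ?thesis using 2 by (simp add: \<gamma>_def)
    qed (use adj0 \<alpha> \<beta> in \<open>simp_all add: \<gamma>_def\<close>)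
  qed
  moreover have "\<gamma> 0 = y0" "\<gamma> (int (M + N + 1)) = y0" using \<alpha> \<beta> by (auto simp: \<gamma>_def)
  moreover have "loop_concat p q = (M + N + 1, \<gamma>)"
    by (auto simp: eq loop_concat_def \<gamma>_def)
  ultimately show ?thesis by (simp add: based_loops_def)
qed

lemma map_loop_concat: "map_loop f (loop_concat p q) = loop_concat (map_loop f p) (map_loop f q)"
  by (auto simp: map_loop_def loop_concat_def)

text \<open>Concatenation commutes with subdivision by a common factor, because the length \<open>M + N + 1\<close>
  counts \<open>(M + 1) + (N + 1)\<close> points. Subdividing only one of the factors would change the ratio of
  their lengths.\<close>

lemma loop_concat_subdivided:
  assumes "(M, \<alpha>) \<in> based_loops Y y0" "(N, \<beta>) \<in> based_loops Y y0" "k \<ge> 1"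
    "(subdivided_length k M, \<alpha>') \<in> based_loops Y y0" "(subdivided_length k N, \<beta>') \<in> based_loops Y y0"
    and \<alpha>': "\<And>s. s \<in> interval (subdivided_length k M) \<Longrightarrow> \<alpha>' s = \<alpha> (interval_proj k s)"
    and \<beta>': "\<And>s. s \<in> interval (subdivided_length k N) \<Longrightarrow> \<beta>' s = \<beta> (interval_proj k s)"
  shows "(loop_concat (M, \<alpha>) (N, \<beta>),
    loop_concat (subdivided_length k M, \<alpha>') (subdivided_length k N, \<beta>')) \<in> loop_rel Y y0"
proof -
  let ?M = "subdivided_length k M" and ?N = "subdivided_length k N"
  define \<gamma> where "\<gamma> = snd (loop_concat (M, \<alpha>) (N, \<beta>))"
  define \<gamma>' where "\<gamma>' = snd (loop_concat (?M, \<alpha>') (?N, \<beta>'))"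
  have concat: "loop_concat (M, \<alpha>) (N, \<beta>) = (M + N + 1, \<gamma>)"
    by (simp add: loop_concat_def \<gamma>_def)
  have len: "?M + ?N + 1 = subdivided_length k (M + N + 1)"
    using assms(3) by (cases k) (auto simp: algebra_simps)
  then have concat': "loop_concat (?M, \<alpha>') (?N, \<beta>') = (subdivided_length k (M + N + 1), \<gamma>')"
    by (simp add: loop_concat_def \<gamma>'_def)
  have in1: "(M + N + 1, \<gamma>) \<in> based_loops Y y0"
    using loop_concat_in[OF assms(1,2)] by (simp only: concat)
  have in2: "(subdivided_length k (M + N + 1), \<gamma>') \<in> based_loops Y y0"
    using loop_concat_in[OF assms(4,5)] by (simp only: concat')
  have "(\<gamma> \<circ> interval_proj k) s = \<gamma>' s" if s: "s \<in> interval (subdivided_length k (M + N + 1))" for s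
  proof -
    have iff: "interval_proj k s \<le> int M \<longleftrightarrow> s \<le> int ?M"
    proof -
      have "interval_proj k s \<le> int M" if "s \<le> int ?M"
        using zdiv_mono1[OF that, of "int k"] interval_proj_last[OF assms(3), of M] assms(3)
        by (simp add: interval_proj_def)
      moreover have "int M + 1 \<le> interval_proj k s" if "\<not> s \<le> int ?M"
      proof -
        have "(int M + 1) * int k \<le> s" using that assms(3) by (simp add: of_nat_diff algebra_simps)
        from zdiv_mono1[OF this, of "int k"] show ?thesis
          using assms(3) by (simp add: interval_proj_def)
      qed
      ultimately show ?thesis by linarith
    qed
    show ?thesis
    proof (cases "s \<le> int ?M")
      case True
      then show ?thesis
        using iff \<alpha>'[of s] s by (simp add: \<gamma>_def \<gamma>'_def loop_concat_def interval_def)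
    next
      case False
      have shift: "interval_proj k s - (int M + 1) = interval_proj k (s - (int ?M + 1))"
      proof -
        have "s - (int ?M + 1) = s + (- (int M + 1)) * int k"
          using assms(3) by (simp add: of_nat_diff algebra_simps)
        moreover have "(s + (- (int M + 1)) * int k) div int k = - (int M + 1) + s div int k"
          using assms(3) by (intro div_mult_self1) simp
        ultimately show ?thesis by (simp only: interval_proj_def)
      qed
      have "s - (int ?M + 1) \<in> interval ?N"
        using False s unfolding len[symmetric] by (simp add: interval_def)
      from \<beta>'[OF this] show ?thesis
        using iff False shift by (simp add: \<gamma>_def \<gamma>'_def loop_concat_def)
    qed
  qed
  then have "((subdivided_length k (M + N + 1), \<gamma> \<circ> interval_proj k),
      (subdivided_length k (M + N + 1), \<gamma>')) \<in> loop_rel Y y0"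
    by (intro loop_rel_agree subdivided_loop in1 in2 assms(3))
  with loop_rel_subdivided[OF in1 assms(3)] show ?thesis
    unfolding concat concat' by (rule loop_rel_trans)
qed

section \<open>Lifting loops and homotopies to the subdivision\<close>

lemma digitally_continuous_standard_proj:
  assumes "k \<ge> 1"
  shows "digitally_continuous (subdivision X k) X (standard_proj k)"
  using order_trans[OF interval_proj_short[OF assms]]
  by (auto simp: digitally_continuous_def subdivision_def standard_proj_def adjacent_vec_def
      adjacent_int_def interval_proj_def)

lemma subdivision_basepoint_component:
  assumes "k \<ge> 1"
  shows "int k * x0 $ i \<le> subdivision_basepoint x0 k $ i"
    "subdivision_basepoint x0 k $ i \<le> int k * x0 $ i + int k - 1"
  using assms by (simp_all add: subdivision_basepoint_def)

lemma standard_proj_basepoint: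
  assumes "k \<ge> 1"
  shows "standard_proj k (subdivision_basepoint x0 k) = x0"
proof -
  have "subdivision_basepoint x0 k $ i div int k = x0 $ i" for i
    using subdivision_basepoint_component[OF assms, of x0 i]
      div_eq_iff_between[OF assms, of "subdivision_basepoint x0 k $ i" "x0 $ i"] by blast
  then show ?thesis by (simp add: standard_proj_def vec_eq_iff)
qed

lemma digitally_continuous_of_components:
  assumes "\<And>i. short_on D (h i)" "\<And>p. p \<in> D \<Longrightarrow> (\<chi> i. h i p) \<in> Y"
  shows "digitally_continuous D Y (\<lambda>p. \<chi> i. h i p)"
  unfolding digitally_continuous_def adjacent_iff_sup_dist adjacent_vec_def adjacent_int_def
  using assms(2) order_trans[OF short_onD[OF assms(1)]] by auto

text \<open>A loop is treated as a function on a box of height \<open>0\<close> that ignores the second coordinate; each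
  coordinate is lifted with the value of the basepoint prescribed at the two ends. A prescribed end is
  compatible because a block at distance \<open>d\<close> from the end block is at least \<open>k * d\<close> points away.\<close>

lemma loop_lift:
  fixes X :: "(int ^ 'n) set"
  assumes \<alpha>: "(N, \<alpha>) \<in> based_loops X x0" and "k \<ge> 1"
  obtains \<beta> where
    "(subdivided_length k N, \<beta>) \<in> based_loops (subdivision X k) (subdivision_basepoint x0 k)"
    "\<And>s. s \<in> interval (subdivided_length k N) \<Longrightarrow> standard_proj k (\<beta> s) = \<alpha> (interval_proj k s)"
proof -
  let ?N = "subdivided_length k N" and ?b = "subdivision_basepoint x0 k" and ?\<rho> = "interval_proj k"
  let ?D = "interval ?N \<times> interval (subdivided_length k 0)"
  let ?B = "{e. end_of ?N e} \<times> {0}"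
  have cont: "digitally_continuous (interval N) X \<alpha>" and ends: "\<And>e. end_of N e \<Longrightarrow> \<alpha> e = x0"
    using \<alpha> by (auto simp: based_loops_def end_of_def)
  have "\<exists>h. short_on ?D h \<and> (\<forall>p\<in>?D. h p div int k = \<alpha> (?\<rho> (fst p)) $ i) \<and> (\<forall>e\<in>?B. h e = ?b $ i)" for i
  proof -
    have a: "short_on (interval N \<times> interval 0) (\<lambda>p. \<alpha> (fst p) $ i)"
      unfolding short_on_def sup_dist_def
    proof (intro ballI)
      fix p q assume "p \<in> interval N \<times> interval 0" "q \<in> interval N \<times> interval 0"
      then have "\<bar>\<alpha> (fst p) $ i - \<alpha> (fst q) $ i\<bar> \<le> \<bar>fst p - fst q\<bar>"
        by (intro short_path_component[OF cont]) auto
      then show "\<alpha> (fst p) $ i - \<alpha> (fst q) $ i \<le> max \<bar>fst p - fst q\<bar> \<bar>snd p - snd q\<bar>" by linarith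
    qed
    have B: "?B \<subseteq> ?D" using end_of_in by (auto simp: interval_def)
    have f: "short_on ?B (\<lambda>_. ?b $ i)" by (auto simp: short_on_def sup_dist_def)
    have compat: "int k * \<alpha> (fst (block k p)) $ i - ?b $ i \<le> sup_dist e p \<and>
        ?b $ i - (int k * \<alpha> (fst (block k p)) $ i + int k - 1) \<le> sup_dist e p"
      if "e \<in> ?B" "p \<in> ?D" for e p
    proof -
      have e: "end_of ?N (fst e)" and p: "fst p \<in> interval ?N" using that by auto
      define x where "x = \<alpha> (?\<rho> (fst p)) $ i"
      have "end_of N (?\<rho> (fst e))" by (rule end_of_interval_proj[OF \<open>k \<ge> 1\<close> e])
      then have "\<bar>x0 $ i - x\<bar> \<le> \<bar>?\<rho> (fst e) - ?\<rho> (fst p)\<bar>"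
        using short_path_component[OF cont end_of_in interval_proj_in[OF \<open>k \<ge> 1\<close> p]] ends
        by (metis x_def)
      then have "int k * \<bar>x0 $ i - x\<bar> \<le> int k * \<bar>?\<rho> (fst e) - ?\<rho> (fst p)\<bar>"
        by (rule mult_left_mono) simp
      also have "\<dots> \<le> \<bar>fst e - fst p\<bar>" by (rule end_block_distance[OF \<open>k \<ge> 1\<close> e p])
      also have "\<dots> \<le> sup_dist e p" by (simp add: sup_dist_def)
      finally have "int k * \<bar>x0 $ i - x\<bar> \<le> sup_dist e p" .
      moreover have "int k * (x0 $ i - x) \<le> int k * \<bar>x0 $ i - x\<bar>"
        "int k * (x - x0 $ i) \<le> int k * \<bar>x0 $ i - x\<bar>"
        by (rule mult_left_mono; simp)+
      ultimately show ?thesis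
        using subdivision_basepoint_component[OF \<open>k \<ge> 1\<close>, of x0 i]
        by (simp add: block_def x_def[symmetric] right_diff_distrib)
    qed
    show ?thesis
      using short_lift_extending[OF \<open>k \<ge> 1\<close> order_refl a B f compat] 
      by (metis (no_types, lifting) block_def fst_map_prod)
  qed
  then obtain h where h: "\<And>i. short_on ?D (h i)"
      "\<And>i p. p \<in> ?D \<Longrightarrow> h i p div int k = \<alpha> (?\<rho> (fst p)) $ i"
      "\<And>i e. e \<in> ?B \<Longrightarrow> h i e = ?b $ i"
    by metis
  define \<beta> where "\<beta> s = (\<chi> i. h i (s, 0))" for s
  have D: "(s, 0) \<in> ?D" if "s \<in> interval ?N" for s using that by (simp add: interval_def)
  have proj: "standard_proj k (\<beta> s) = \<alpha> (?\<rho> s)" if "s \<in> interval ?N" for s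
    using h(2)[OF D[OF that]] by (simp add: standard_proj_def \<beta>_def vec_eq_iff)
  have in_S: "\<beta> s \<in> subdivision X k" if "s \<in> interval ?N" for s
    using proj[OF that] interval_proj_in[OF \<open>k \<ge> 1\<close> that] cont
    by (auto simp: subdivision_def digitally_continuous_def)
  have "digitally_continuous (interval ?N) (subdivision X k) \<beta>"
    unfolding digitally_continuous_def
  proof (intro conjI ballI impI)
    fix s s' assume s: "s \<in> interval ?N" "s' \<in> interval ?N" "adjacent s s'"
    then have "\<bar>h i (s, 0) - h i (s', 0)\<bar> \<le> 1" for i
      using short_onD[OF h(1) D[OF s(1)] D[OF s(2)], of i] by (simp add: sup_dist_def adjacent_int_def)
    then show "adjacent (\<beta> s) (\<beta> s')" by (simp add: \<beta>_def adjacent_vec_def adjacent_int_def)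
  qed (use in_S in blast)
  moreover have "\<beta> e = ?b" if "end_of ?N e" for e
    using h(3)[of "(e, 0)"] that by (simp add: \<beta>_def vec_eq_iff)
  then have "\<beta> 0 = ?b" "\<beta> (int ?N) = ?b" by (auto simp: end_of_def)
  moreover have "?N \<ge> 1" using subdivided_loop[OF assms] by (simp add: based_loops_def)
  ultimately have "(?N, \<beta>) \<in> based_loops (subdivision X k) ?b"
    by (simp add: based_loops_def)
  then show ?thesis using proj that by blast
qed

text \<open>In each coordinate this is \<open>short_lift_rel_frame\<close>. The lift lies in the subdivision of \<open>X\<close>,
  since its projection is the subdivided homotopy, which has values in \<open>X\<close>.\<close>

lemma homotopy_lift:
  fixes X :: "(int ^ 'n) set"
  assumes "k \<ge> 1" and b: "standard_proj k b = x0"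
    and \<gamma>: "(N, \<gamma>) \<in> based_loops (subdivision X k) b" and \<delta>: "(N, \<delta>) \<in> based_loops (subdivision X k) b"
    and hom: "based_homotopic X x0 N (standard_proj k \<circ> \<gamma>) (standard_proj k \<circ> \<delta>)"
  shows "based_homotopic (subdivision X k) b (subdivided_length (3 * k) N)
    (\<gamma> \<circ> interval_proj (3 * k)) (\<delta> \<circ> interval_proj (3 * k))"
proof -
  define K where "K = 3 * k"
  have K1: "K \<ge> 1" using \<open>k \<ge> 1\<close> by (simp add: K_def)
  let ?\<rho> = "interval_proj K"
  obtain R H where H: "R \<ge> 1" "digitally_continuous (interval N \<times> interval R) X H"
    "\<And>s. s \<in> interval N \<Longrightarrow> H (s, 0) = (standard_proj k \<circ> \<gamma>) s"
    "\<And>s. s \<in> interval N \<Longrightarrow> H (s, int R) = (standard_proj k \<circ> \<delta>) s"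
    "\<And>t. t \<in> interval R \<Longrightarrow> H (0, t) = x0" "\<And>t. t \<in> interval R \<Longrightarrow> H (int N, t) = x0"
    using hom by (rule based_homotopicE) blast
  let ?N = "subdivided_length K N" and ?M = "subdivided_length K R"
  let ?D = "interval ?N \<times> interval ?M"
  have \<gamma>': "digitally_continuous (interval N) (subdivision X k) \<gamma>" "\<gamma> 0 = b" "\<gamma> (int N) = b"
    and \<delta>': "digitally_continuous (interval N) (subdivision X k) \<delta>" "\<delta> 0 = b" "\<delta> (int N) = b"
    using \<gamma> \<delta> by (auto simp: based_loops_def)
  \<comment> \<open>The lift prescribed on the frame: the basepoint on the vertical edges, the two loops on the
    horizontal ones.\<close>
  define G where "G p = (if end_of N (fst p) then b else if snd p = 0 then \<gamma> (fst p) else \<delta> (fst p))"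
    for p :: "int \<times> int"
  have G: "G (s, 0) = \<gamma> s" "G (s, int R) = \<delta> s" for s
    using \<gamma>' \<delta>' H(1) by (auto simp: G_def end_of_def)
  have G': "G (e, t) = b" if "end_of N e" for e t using that by (simp add: G_def)
  have GH: "standard_proj k (G p) = H p" if "p \<in> frame N R" for p
  proof -
    obtain s t where p: "p = (s, t)" by fastforce
    have st: "s \<in> interval N" "t \<in> interval R" using that by (auto simp: frame_def p)
    show ?thesis
    proof (cases "end_of N s")
      case True
      then show ?thesis using H(5,6)[OF st(2)] b by (auto simp: p G' end_of_def)
    next
      case False
      then have "t = 0 \<or> t = int R" using that by (auto simp: frame_def p end_of_def)
      then show ?thesis using H(3,4)[OF st(1)] by (auto simp: p G)
    qed
  qed
  have "\<exists>h. short_on ?D h \<and> (\<forall>p\<in>?D. h p div int k = H (block K p) $ i) \<and>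
      (\<forall>p\<in>frame ?N ?M. h p = G (block K p) $ i)" for i
  proof -
    have g: "short_along_edges N R (\<lambda>p. G p $ i)"
      unfolding short_along_edges_def
      using short_path_component[OF \<gamma>'(1)] short_path_component[OF \<delta>'(1)]
      by (auto simp: G' end_of_def[of R] G)
    have ga: "G p $ i div int k = H p $ i" if "p \<in> frame N R" for p
      using GH[OF that] by (auto simp: standard_proj_def vec_eq_iff)
    show ?thesis
      using short_lift_rel_frame[OF \<open>k \<ge> 1\<close> K_def short_on_component[OF H(2)] g ga] by metis
  qed
  then obtain h where h: "\<And>i. short_on ?D (h i)"
      "\<And>i p. p \<in> ?D \<Longrightarrow> h i p div int k = H (block K p) $ i"
      "\<And>i p. p \<in> frame ?N ?M \<Longrightarrow> h i p = G (block K p) $ i"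
    by metis
  define F where "F p = (\<chi> i. h i p)" for p
  have "standard_proj k (F p) = H (block K p)" if "p \<in> ?D" for p
    using h(2)[OF that] by (simp add: standard_proj_def F_def vec_eq_iff)
  then have "F p \<in> subdivision X k" if "p \<in> ?D" for p
    using that block_in[OF K1 that] H(2) by (auto simp: subdivision_def digitally_continuous_def)
  then have F: "digitally_continuous ?D (subdivision X k) F"
    unfolding F_def by (intro digitally_continuous_of_components h(1))
  have FG: "F (s, t) = G (?\<rho> s, ?\<rho> t)" if "(s, t) \<in> frame ?N ?M" for s t
    using h(3)[OF that] by (simp add: F_def vec_eq_iff block_def)
  have "based_homotopic (subdivision X k) b ?N (\<gamma> \<circ> ?\<rho>) (\<delta> \<circ> ?\<rho>)"
  proof (rule based_homotopicI[OF _ F])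
    show "?M \<ge> 1" using H(1) K1 by (cases K; cases R) auto
    fix s assume s: "s \<in> interval ?N"
    then have "(s, 0) \<in> frame ?N ?M" "(s, int ?M) \<in> frame ?N ?M"
      using end_of_in[of ?M] by (auto simp: frame_def end_of_def)
    then show "F (s, 0) = (\<gamma> \<circ> ?\<rho>) s" "F (s, int ?M) = (\<delta> \<circ> ?\<rho>) s"
      using interval_proj_last[OF K1, of R] by (simp_all only: FG interval_proj_0 G o_apply)
  next
    fix t assume t: "t \<in> interval ?M"
    then have "(0, t) \<in> frame ?N ?M" "(int ?N, t) \<in> frame ?N ?M"
      using end_of_in[of ?N] by (auto simp: frame_def end_of_def)
    moreover have "end_of N (?\<rho> 0)" "end_of N (?\<rho> (int ?N))"
      using end_of_interval_proj[OF K1, of N] by (auto simp: end_of_def)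
    ultimately show "F (0, t) = b" "F (int ?N, t) = b"
      by (simp_all only: FG G')
  qed
  then show ?thesis by (simp only: K_def)
qed

text \<open>Injectivity on classes. A relation between the projected loops is a homotopy between their
  subdivisions by \<open>m\<close> and \<open>n\<close>, which lifts to one between the subdivisions of the original loops by
  \<open>m * (3 * k)\<close> and \<open>n * (3 * k)\<close>.\<close>

lemma loop_rel_lift:
  fixes X :: "(int ^ 'n) set"
  assumes "k \<ge> 1" and b: "standard_proj k b = x0"
    and p: "p \<in> based_loops (subdivision X k) b" and q: "q \<in> based_loops (subdivision X k) b"
    and rel: "(map_loop (standard_proj k) p, map_loop (standard_proj k) q) \<in> loop_rel X x0"
  shows "(p, q) \<in> loop_rel (subdivision X k) b"
proof -
  obtain M \<gamma> N \<delta> where eq: "p = (M, \<gamma>)" "q = (N, \<delta>)" by fastforce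
  obtain m n where mn: "m \<ge> 1" "n \<ge> 1" "subdivided_length m M = subdivided_length n N"
    "based_homotopic X x0 (subdivided_length m M)
      ((standard_proj k \<circ> \<gamma>) \<circ> interval_proj m) ((standard_proj k \<circ> \<delta>) \<circ> interval_proj n)"
    using rel unfolding eq map_loop_def fst_conv snd_conv by (rule loop_relE)
  have loops: "(subdivided_length m M, \<gamma> \<circ> interval_proj m) \<in> based_loops (subdivision X k) b"
    "(subdivided_length m M, \<delta> \<circ> interval_proj n) \<in> based_loops (subdivision X k) b"
    using subdivided_loop p q mn unfolding eq by metis+
  have comp: "(\<epsilon> \<circ> interval_proj i) \<circ> interval_proj j = \<epsilon> \<circ> interval_proj (i * j)"
    for \<epsilon> :: "int \<Rightarrow> int ^ 'n" and i j
    by (auto simp: interval_proj_interval_proj)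
  have k3: "3 * k \<ge> 1" using \<open>k \<ge> 1\<close> by simp
  have "based_homotopic (subdivision X k) b (subdivided_length (3 * k) (subdivided_length m M))
      ((\<gamma> \<circ> interval_proj m) \<circ> interval_proj (3 * k)) ((\<delta> \<circ> interval_proj n) \<circ> interval_proj (3 * k))"
    using homotopy_lift[OF \<open>k \<ge> 1\<close> b loops] mn(4) by (simp only: comp_assoc)
  then have "based_homotopic (subdivision X k) b (subdivided_length (m * (3 * k)) M)
      (\<gamma> \<circ> interval_proj (m * (3 * k))) (\<delta> \<circ> interval_proj (n * (3 * k)))"
    by (simp only: comp subdivided_length_mult[OF mn(1) k3])
  moreover have "subdivided_length (m * (3 * k)) M = subdivided_length (n * (3 * k)) N"
    using subdivided_length_mult[OF mn(1) k3, of M] subdivided_length_mult[OF mn(2) k3, of N] mn(3)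
    by metis
  moreover have "m * (3 * k) \<ge> 1" "n * (3 * k) \<ge> 1" using mn \<open>k \<ge> 1\<close> by simp_all
  ultimately show ?thesis
    using p q unfolding eq by (intro loop_relI)
qed

text \<open>A lift of \<open>q\<close> projects to the \<open>k\<close>-subdivision of \<open>q\<close>, which is related to \<open>q\<close>.\<close>

lemma map_loop_lift_rel:
  assumes q: "q \<in> based_loops X x0" and p: "p \<in> based_loops S b"
    and f: "digitally_continuous S X f" "f b = x0" and "k \<ge> 1"
    and len: "fst p = subdivided_length k (fst q)"
    and lift: "\<And>s. s \<in> interval (fst p) \<Longrightarrow> f (snd p s) = snd q (interval_proj k s)"
  shows "(q, map_loop f p) \<in> loop_rel X x0"
proof -
  have q': "(fst q, snd q) \<in> based_loops X x0" using q by simp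
  have "((subdivided_length k (fst q), snd q \<circ> interval_proj k), map_loop f p) \<in> loop_rel X x0"
    using map_loop_in[OF p f] subdivided_loop[OF q' \<open>k \<ge> 1\<close>] lift
    unfolding map_loop_def len[symmetric] by (intro loop_rel_agree) auto
  with loop_rel_subdivided[OF q' \<open>k \<ge> 1\<close>] show ?thesis
    unfolding prod.collapse by (rule loop_rel_trans)
qed

section \<open>The isomorphism\<close>

text \<open>A lift of \<open>q\<close> has the same projected class as any representative of \<open>C\<close>, so by injectivity it
  belongs to \<open>C\<close>.\<close>

lemma loop_lift_in_class:
  fixes X :: "(int ^ 'n) set" and x0 :: "int ^ 'n" and k :: nat
  defines "\<rho> \<equiv> standard_proj k"
  assumes "k \<ge> 1"
    and C: "C \<in> based_loops (subdivision X k) (subdivision_basepoint x0 k) //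
      loop_rel (subdivision X k) (subdivision_basepoint x0 k)"
    and q: "q \<in> induced_map X x0 \<rho> C"
  obtains p where "p \<in> C" "fst p = subdivided_length k (fst q)"
    "\<And>s. s \<in> interval (fst p) \<Longrightarrow> \<rho> (snd p s) = snd q (interval_proj k s)"
proof -
  let ?S = "subdivision X k" and ?b = "subdivision_basepoint x0 k"
  have \<rho>: "digitally_continuous ?S X \<rho>" "\<rho> ?b = x0"
    unfolding \<rho>_def using digitally_continuous_standard_proj standard_proj_basepoint \<open>k \<ge> 1\<close> by blast+
  obtain p0 where p0: "p0 \<in> C" "(map_loop \<rho> p0, q) \<in> loop_rel X x0"
    using q by (auto simp: mem_induced_map)
  have p0_in: "p0 \<in> based_loops ?S ?b"
    using p0(1) C in_quotient_imp_subset[OF equiv_loop_rel] by blast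
  have q_in: "q \<in> based_loops X x0" using loop_relD[OF p0(2)] by blast
  then have "(fst q, snd q) \<in> based_loops X x0" by simp
  then obtain \<beta> where \<beta>: "(subdivided_length k (fst q), \<beta>) \<in> based_loops ?S ?b"
    "\<And>s. s \<in> interval (subdivided_length k (fst q)) \<Longrightarrow> \<rho> (\<beta> s) = snd q (interval_proj k s)"
    using loop_lift[OF _ \<open>k \<ge> 1\<close>] unfolding \<rho>_def by blast
  define p where "p = (subdivided_length k (fst q), \<beta>)"
  have p: "p \<in> based_loops ?S ?b" "fst p = subdivided_length k (fst q)"
    "\<And>s. s \<in> interval (fst p) \<Longrightarrow> \<rho> (snd p s) = snd q (interval_proj k s)"
    using \<beta> by (simp_all add: p_def)
  have "(q, map_loop \<rho> p) \<in> loop_rel X x0"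
    using map_loop_lift_rel[OF q_in p(1) \<rho> \<open>k \<ge> 1\<close> p(2,3)] .
  from loop_rel_trans[OF p0(2) this] have "(p0, p) \<in> loop_rel ?S ?b"
    unfolding \<rho>_def by (rule loop_rel_lift[OF \<open>k \<ge> 1\<close> \<rho>(2)[unfolded \<rho>_def] p0_in p(1)])
  then have "p \<in> C" using in_quotient_imp_closed[OF equiv_loop_rel C p0(1)] by blast
  with p(2,3) show ?thesis using that by blast
qed

text \<open>The inclusion from left to right holds since projecting commutes with concatenating. For the other
  one, arbitrary representatives \<open>p'\<close>, \<open>q'\<close> of the image classes have to be reached; their lifts
  inside \<open>A\<close> and \<open>B\<close> do this, as both come with the same subdivision factor.\<close>

lemma induced_map_standard_proj_mult:
  fixes X :: "(int ^ 'n) set" and x0 :: "int ^ 'n" and k :: nat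
  defines "\<rho> \<equiv> standard_proj k" and "LS \<equiv> based_loops (subdivision X k) (subdivision_basepoint x0 k)"
    and "RS \<equiv> loop_rel (subdivision X k) (subdivision_basepoint x0 k)"
  assumes "k \<ge> 1" and A: "A \<in> LS // RS" and B: "B \<in> LS // RS"
  shows "induced_map X x0 \<rho> (\<Union>p\<in>A. \<Union>q\<in>B. RS `` {loop_concat p q}) =
    (\<Union>p\<in>induced_map X x0 \<rho> A. \<Union>q\<in>induced_map X x0 \<rho> B. loop_rel X x0 `` {loop_concat p q})"
    (is "?hAB = ?hAhB")
proof (intro Set.set_eqI iffI)
  let ?h = "induced_map X x0 \<rho>"
  have \<rho>: "digitally_continuous (subdivision X k) X \<rho>" "\<rho> (subdivision_basepoint x0 k) = x0"
    unfolding \<rho>_def using digitally_continuous_standard_proj standard_proj_basepoint \<open>k \<ge> 1\<close> by blast+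
  have LS: "p \<in> LS" if "p \<in> C" "C \<in> LS // RS" for p C
    using that in_quotient_imp_subset[OF equiv_loop_rel] unfolding LS_def RS_def by blast
  have push: "map_loop \<rho> p \<in> based_loops X x0" if "p \<in> LS" for p
    using map_loop_in[OF that[unfolded LS_def] \<rho>] .
  fix r
  {
    assume "r \<in> ?hAB"
    then obtain p q c where pq: "p \<in> A" "q \<in> B" "(loop_concat p q, c) \<in> RS"
        "(map_loop \<rho> c, r) \<in> loop_rel X x0"
      by (auto simp: mem_induced_map)
    have "map_loop \<rho> p \<in> ?h A"
      unfolding mem_induced_map using loop_rel_refl[OF push[OF LS[OF pq(1) A]]] pq(1) by (rule bexI)
    moreover have "map_loop \<rho> q \<in> ?h B"
      unfolding mem_induced_map using loop_rel_refl[OF push[OF LS[OF pq(2) B]]] pq(2) by (rule bexI)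
    moreover have "(loop_concat (map_loop \<rho> p) (map_loop \<rho> q), r) \<in> loop_rel X x0"
      using loop_rel_trans[OF loop_rel_push[OF pq(3)[unfolded RS_def] \<rho>] pq(4)]
      by (simp only: map_loop_concat)
    ultimately show "r \<in> ?hAhB" by blast
  next
    assume "r \<in> ?hAhB"
    then obtain p' q' where p'q': "p' \<in> ?h A" "q' \<in> ?h B" "(loop_concat p' q', r) \<in> loop_rel X x0"
      by blast
    obtain p where p: "p \<in> A" "fst p = subdivided_length k (fst p')"
        "\<And>s. s \<in> interval (fst p) \<Longrightarrow> \<rho> (snd p s) = snd p' (interval_proj k s)"
      using loop_lift_in_class[OF \<open>k \<ge> 1\<close> A[unfolded LS_def RS_def] p'q'(1)[unfolded \<rho>_def]]
      unfolding \<rho>_def by blast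
    obtain q where q: "q \<in> B" "fst q = subdivided_length k (fst q')"
        "\<And>s. s \<in> interval (fst q) \<Longrightarrow> \<rho> (snd q s) = snd q' (interval_proj k s)"
      using loop_lift_in_class[OF \<open>k \<ge> 1\<close> B[unfolded LS_def RS_def] p'q'(2)[unfolded \<rho>_def]]
      unfolding \<rho>_def by blast
    have loops: "p' \<in> based_loops X x0" "q' \<in> based_loops X x0"
      using p'q'(1,2) by (auto simp: mem_induced_map dest: loop_relD)
    have "(loop_concat (fst p', snd p') (fst q', snd q'),
        loop_concat (subdivided_length k (fst p'), \<rho> \<circ> snd p) (subdivided_length k (fst q'), \<rho> \<circ> snd q))
        \<in> loop_rel X x0"
      using loops push[OF LS[OF p(1) A]] push[OF LS[OF q(1) B]] p(2,3) q(2,3) \<open>k \<ge> 1\<close>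
      by (intro loop_concat_subdivided) (simp_all add: map_loop_def)
    then have "(loop_concat p' q', map_loop \<rho> (loop_concat p q)) \<in> loop_rel X x0"
      unfolding map_loop_concat by (simp add: map_loop_def p(2) q(2))
    then have "(map_loop \<rho> (loop_concat p q), r) \<in> loop_rel X x0"
      using loop_rel_trans[OF loop_rel_sym p'q'(3)] by blast
    moreover have "(loop_concat p q, loop_concat p q) \<in> RS"
      using loop_rel_refl[OF loop_concat_in[OF LS[OF p(1) A, unfolded LS_def] LS[OF q(1) B, unfolded LS_def]]]
      unfolding RS_def .
    ultimately show "r \<in> ?hAB"
      unfolding mem_induced_map using p(1) q(1) by (intro bexI[of _ "loop_concat p q"]) auto
  }
qed

theorem theorem3p16:
  fixes X :: "(int ^ 'n) set" and x0 :: "int ^ 'n" and k :: nat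
  assumes "finite X" and "x0 \<in> X" and "k \<ge> 1"
  shows "induced_map X x0 (standard_proj k)
    \<in> iso (fundamental_group (subdivision X k) (subdivision_basepoint x0 k))
          (fundamental_group X x0)"
proof -
  let ?\<rho> = "standard_proj k" and ?S = "subdivision X k" and ?b = "subdivision_basepoint x0 k"
  let ?h = "induced_map X x0 ?\<rho>"
  let ?LS = "based_loops ?S ?b" and ?LX = "based_loops X x0"
  let ?RS = "loop_rel ?S ?b" and ?RX = "loop_rel X x0"
  have \<rho>: "digitally_continuous ?S X ?\<rho>" "?\<rho> ?b = x0"
    using digitally_continuous_standard_proj standard_proj_basepoint \<open>k \<ge> 1\<close> by blast+
  have class_eq: "?h (?RS `` {p}) = ?RX `` {map_loop ?\<rho> p}" if "p \<in> ?LS" for p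
    using induced_map_class[OF that \<rho>] .
  have push: "map_loop ?\<rho> p \<in> ?LX" if "p \<in> ?LS" for p
    using map_loop_in[OF that \<rho>] .
  have in_carrier: "?h A \<in> ?LX // ?RX" if "A \<in> ?LS // ?RS" for A
    using that by (elim quotientE) (simp add: class_eq quotientI push)
  have inj: "inj_on ?h (?LS // ?RS)"
  proof (rule inj_onI)
    fix A B assume "A \<in> ?LS // ?RS" "B \<in> ?LS // ?RS" and eq: "?h A = ?h B"
    then obtain p q where p: "p \<in> ?LS" "A = ?RS `` {p}" and q: "q \<in> ?LS" "B = ?RS `` {q}"
      by (metis quotientE)
    have "(map_loop ?\<rho> p, map_loop ?\<rho> q) \<in> ?RX"
      using eq eq_equiv_class[OF _ equiv_loop_rel push[OF q(1)]] by (simp add: p q class_eq)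
    from loop_rel_lift[OF \<open>k \<ge> 1\<close> \<rho>(2) p(1) q(1) this] show "A = B"
      unfolding p(2) q(2) by (rule equiv_class_eq[OF equiv_loop_rel])
  qed
  have "?h ` (?LS // ?RS) = ?LX // ?RX"
  proof (intro equalityI subsetI)
    fix Q assume "Q \<in> ?LX // ?RX"
    then obtain q where q: "q \<in> ?LX" "Q = ?RX `` {q}" by (rule quotientE)
    then have "(fst q, snd q) \<in> ?LX" by simp
    then obtain \<beta> where \<beta>: "(subdivided_length k (fst q), \<beta>) \<in> ?LS"
      "\<And>s. s \<in> interval (subdivided_length k (fst q)) \<Longrightarrow> ?\<rho> (\<beta> s) = snd q (interval_proj k s)"
      using loop_lift[OF _ \<open>k \<ge> 1\<close>] by blast
    have "(q, map_loop ?\<rho> (subdivided_length k (fst q), \<beta>)) \<in> ?RX"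
      using map_loop_lift_rel[OF q(1) \<beta>(1) \<rho> \<open>k \<ge> 1\<close>] \<beta>(2) by simp
    then have "Q = ?h (?RS `` {(subdivided_length k (fst q), \<beta>)})"
      unfolding q(2) class_eq[OF \<beta>(1)] by (rule equiv_class_eq[OF equiv_loop_rel])
    then show "Q \<in> ?h ` (?LS // ?RS)" using \<beta>(1) by (blast intro: quotientI)
  qed (use in_carrier in blast)
  with inj have bij: "bij_betw ?h (?LS // ?RS) (?LX // ?RX)" by (simp add: bij_betw_def)
  have mult: "?h (\<Union>p\<in>A. \<Union>q\<in>B. ?RS `` {loop_concat p q}) =
      (\<Union>p\<in>?h A. \<Union>q\<in>?h B. ?RX `` {loop_concat p q})"
    if "A \<in> ?LS // ?RS" "B \<in> ?LS // ?RS" for A B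
    by (rule induced_map_standard_proj_mult[OF \<open>k \<ge> 1\<close> that])
  show ?thesis
    unfolding iso_def hom_def fundamental_group_def
    using in_carrier mult bij by (simp add: Pi_iff)
qed

end
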